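(* Let $\pi:\mathbb{N}_0\to\mathbb{N}_0$ be defined recursively by: $\pi(n)$ is the least non-negative integer $m$ such that for every $j\in\{0,\ldots,n-1\}$ we have $m\ne\pi(j)$, $m\ne\pi(j)+(n-j)$, $m\ne\pi(j)+2(n-j)$ and $m\ne\pi(j)+\frac{n-j}{2}$. Let $(a_n)_{n\in\mathbb{N}_0}$ be the increasing enumeration of $\{n\in\mathbb{N}_0\mid\pi(n)\ge n\}$ and $b_n=\pi(a_n)$. Then the limit $\lim_{n\to\infty}\frac{b_n}{a_n}$ does not exist (neither as a real number nor as $+\infty$).
   Context: The pairs $\{a_n,b_n\}$ are exactly the $P$-positions (up to order of coordinates) of the game $(1,2)\mathrm{GDWN}$: from $(x,y)\in\mathbb{N}_0^2$ a player may move to $(x-m,y-n)\in\mathbb{N}_0^2$ where $(m,n)\in\{(0,t),(t,0),(t,t),(t,2t),(2t,t)\}$ for some $t\in\mathbb{N}$; the player unable to move loses. *)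

theory Defs
  imports Complex_Main "HOL-Library.Infinite_Set"
begin

text \<open>
  The last condition is stated over the reals, since \<open>(n - j) / 2\<close> need not be an integer;
  for odd \<open>n - j\<close> it holds trivially.  The subtraction \<open>n - j\<close> on naturals never truncates
  because \<open>j < n\<close>.
\<close>
fun \<pi> :: "nat \<Rightarrow> nat" where
  "\<pi> n = (LEAST m. \<forall>j\<in>{..<n}. m \<noteq> \<pi> j \<and> m \<noteq> \<pi> j + (n - j) \<and> m \<noteq> \<pi> j + 2 * (n - j) \<and>
     real m \<noteq> real (\<pi> j) + real (n - j) / 2)"

declare \<pi>.simps [simp del]

definition a_seq :: "nat \<Rightarrow> nat" where
  "a_seq = enumerate {n. \<pi> n \<ge> n}"

definition b_seq :: "nat \<Rightarrow> nat" where
  "b_seq n = \<pi> (a_seq n)"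

text \<open>
  The set of admissible values in the recursion for \<open>\<pi>\<close> is never empty, and \<open>a_seq\<close> enumerates an
  infinite set, so \<open>LEAST\<close> and \<open>enumerate\<close> are used within their intended domains.  The latter
  fact follows from \<open>\<pi>\<close> being an involution, because its graph is the (symmetric) set of
  P-positions of the game.
\<close>

abbreviation admissible :: "nat \<Rightarrow> nat \<Rightarrow> bool" where
  "admissible n m \<equiv> \<forall>j\<in>{..<n}. m \<noteq> \<pi> j \<and> m \<noteq> \<pi> j + (n - j) \<and> m \<noteq> \<pi> j + 2 * (n - j) \<and>
     real m \<noteq> real (\<pi> j) + real (n - j) / 2"

lemma admissible_exists: "\<exists>m. admissible n m"
proof -
  obtain M where M: "\<And>j. j < n \<Longrightarrow> \<pi> j \<le> M"
    by (metis finite_imageI finite_lessThan finite_nat_set_iff_bounded_le imageI lessThan_iff)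
  have "admissible n (M + 2 * n + 1)"
  proof
    fix j assume "j \<in> {..<n}"
    with M[of j] have "\<pi> j \<le> M" "j < n" by auto
    moreover from this have "real (M + 2 * n + 1) \<noteq> real (\<pi> j) + real (n - j) / 2"
      by (simp add: of_nat_diff field_simps)
    ultimately show "M + 2 * n + 1 \<noteq> \<pi> j \<and> M + 2 * n + 1 \<noteq> \<pi> j + (n - j) \<and>
        M + 2 * n + 1 \<noteq> \<pi> j + 2 * (n - j) \<and>
        real (M + 2 * n + 1) \<noteq> real (\<pi> j) + real (n - j) / 2"
      by auto
  qed
  then show ?thesis by blast
qed

lemma admissible_\<pi>: "admissible n (\<pi> n)"
  using LeastI_ex[OF admissible_exists[of n]] by (simp only: \<pi>.simps[of n])

lemma not_admissible_less: "m < \<pi> n \<Longrightarrow> \<not> admissible n m"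
  by (subst (asm) \<pi>.simps) (rule not_less_Least)

definition move :: "nat \<times> nat \<Rightarrow> nat \<times> nat \<Rightarrow> bool" where
  "move p q \<longleftrightarrow> (\<exists>t>0. \<exists>(m, n)\<in>{(0, t), (t, 0), (t, t), (t, 2 * t), (2 * t, t)}.
     fst p = fst q + m \<and> snd p = snd q + n)"

lemma move_swap: "move (x, y) (u, v) \<longleftrightarrow> move (y, x) (v, u)"
  unfolding move_def by auto

lemma move_less: "move p q \<Longrightarrow> fst q + snd q < fst p + snd p"
  unfolding move_def by auto

lemma move_iff:
  assumes "d > 0"
  shows "move (j + d, m) (j, k) \<longleftrightarrow>
    m = k \<or> m = k + d \<or> m = k + 2 * d \<or> real m = real k + real d / 2"
proof -
  have "real m = real k + real d / 2 \<longleftrightarrow> real (2 * m) = real (2 * k + d)"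
    by (simp add: field_simps)
  also have "\<dots> \<longleftrightarrow> 2 * m = 2 * k + d"
    by (rule of_nat_eq_iff)
  also have "\<dots> \<longleftrightarrow> (\<exists>t. d = 2 * t \<and> m = k + t)"
    by presburger
  finally have half: "real m = real k + real d / 2 \<longleftrightarrow> (\<exists>t. d = 2 * t \<and> m = k + t)" .
  have "move (j + d, m) (j, k) \<longleftrightarrow> (\<exists>t>0. d = 0 \<and> m = k + t \<or> d = t \<and> m = k \<or>
      d = t \<and> m = k + t \<or> d = t \<and> m = k + 2 * t \<or> d = 2 * t \<and> m = k + t)"
    by (simp add: move_def)
  also have "\<dots> \<longleftrightarrow> m = k \<or> m = k + d \<or> m = k + 2 * d \<or> (\<exists>t. d = 2 * t \<and> m = k + t)"
    using assms by auto
  finally show ?thesis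
    by (simp only: half)
qed

lemma not_admissible_iff:
  "\<not> admissible n m \<longleftrightarrow> (\<exists>j<n. move (n, m) (j, \<pi> j))"
proof -
  have "move (n, m) (j, \<pi> j) \<longleftrightarrow> m = \<pi> j \<or> m = \<pi> j + (n - j) \<or> m = \<pi> j + 2 * (n - j) \<or>
      real m = real (\<pi> j) + real (n - j) / 2" if "j < n" for j
    using move_iff[of "n - j" j m "\<pi> j"] that by simp
  then show ?thesis
    unfolding Ball_def lessThan_iff by blast
qed

lemma \<pi>_kernel: "m = \<pi> n \<longleftrightarrow> (\<forall>x. \<not> move (n, m) (x, \<pi> x))"
proof -
  have vert: "move (n, m) (n, \<pi> n) \<longleftrightarrow> \<pi> n < m"
  proof
    show "move (n, m) (n, \<pi> n)" if "\<pi> n < m"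
      unfolding move_def using that by (intro exI[of _ "m - \<pi> n"]) auto
  qed (auto simp: move_def)
  have le: "x \<le> n" if "move (n, m) (x, \<pi> x)" for x
    using that unfolding move_def by auto
  have "(\<forall>x. \<not> move (n, m) (x, \<pi> x)) \<longleftrightarrow> admissible n m \<and> m \<le> \<pi> n"
    using vert le not_admissible_iff[of n m] by (metis le_neq_implies_less leD leI)
  also have "\<dots> \<longleftrightarrow> m = \<pi> n"
    using admissible_\<pi>[of n] not_admissible_less[of m n] by (metis le_neq_implies_less order_refl)
  finally show ?thesis by blast
qed

lemma \<pi>_sym: "m = \<pi> n \<longleftrightarrow> n = \<pi> m"
proof (induction "n + m" arbitrary: n m rule: less_induct)
  case less
  have "(\<exists>x. move (n, m) (x, \<pi> x)) \<longleftrightarrow> (\<exists>x. move (m, n) (x, \<pi> x))"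
  proof
    assume "\<exists>x. move (n, m) (x, \<pi> x)"
    then obtain x where "move (n, m) (x, \<pi> x)" by blast
    then show "\<exists>x. move (m, n) (x, \<pi> x)"
      using less[of x "\<pi> x"] move_less move_swap by (metis fst_conv snd_conv)
  next
    assume "\<exists>x. move (m, n) (x, \<pi> x)"
    then obtain x where "move (m, n) (x, \<pi> x)" by blast
    then show "\<exists>x. move (n, m) (x, \<pi> x)"
      using less[of x "\<pi> x"] move_less move_swap by (metis add.commute fst_conv snd_conv)
  qed
  then show ?case using \<pi>_kernel[of m n] \<pi>_kernel[of n m] by blast
qed

lemma infinite_le_\<pi>: "infinite {n. \<pi> n \<ge> n}"
proof
  let ?S = "{n. \<pi> n \<ge> n}"
  assume "finite ?S"
  moreover have "n \<in> ?S \<union> \<pi> ` ?S" for n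
    using \<pi>_sym[of "\<pi> n" n] by (cases "n \<le> \<pi> n") (auto intro!: image_eqI[of _ _ "\<pi> n"])
  ultimately show False
    by (metis finite_UnI finite_imageI finite_subset infinite_UNIV_nat subsetI)
qed

end

theory Submission
  imports Defs
begin

text \<open>
  If \<open>b_n / a_n\<close> had a limit in \<open>[1, \<infinity>]\<close>, then \<open>a_n / b_n\<close> would tend to some \<open>\<beta> \<in> [0, 1]\<close>.  Since the
  \<open>a_n\<close> and \<open>b_n\<close> partition the positive integers, they have densities \<open>1 / (1 + \<beta>)\<close> and
  \<open>b = \<beta> / (1 + \<beta>)\<close>, and the numbers \<open>b_n - a_n\<close> and \<open>2 b_n - a_n\<close> have densities
  \<open>d = b / (1 - \<beta>)\<close> and \<open>l = b / (2 - \<beta>)\<close>.  Distinctness of the \<open>b_n - a_n\<close> and of the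
  \<open>b_n - 2 a_n\<close> forces \<open>2 \<beta>\<^sup>2 + 2 \<beta> \<le> 1\<close>, so \<open>\<beta> < 1 / 2\<close> and the sector \<open>x \<le> y < 2 x\<close> is
  essentially free of P-positions.  For \<open>x\<close> among the \<open>a_n\<close>, each point of that sector lies on a
  horizontal line, on a diagonal, or on a line of slope 2 or 1/2 through an earlier P-position.
  Counting these lines in two columns of opposite parity, and using that the horizontal lines and
  the diagonals overlap substantially, gives
  \<open>2 + b (d - b) (1 + \<beta>) \<le> 2 b + 2 d + 4 l\<close>, which contradicts the bound on \<open>\<beta>\<close>.
\<close>

section \<open>Line offsets of the P-positions and the sets they form\<close>

definition upper :: "nat set" where
  "upper = {n. n \<le> \<pi> n}"

lemma \<pi>_\<pi> [simp]: "\<pi> (\<pi> n) = n"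
  using \<pi>_sym[of "\<pi> n" n] by simp

lemma inj_\<pi>: "inj \<pi>"
  by (metis \<pi>_\<pi> injI)

text \<open>The three expressions are the offsets of the lines of slope 1, 2 and 1/2 through a point
  of the graph, and the recursion keeps two columns from sharing such a line. The last offset is
  doubled to stay integral.\<close>

lemma \<pi>_neq:
  assumes "j < n"
  shows "int (\<pi> n) - int n \<noteq> int (\<pi> j) - int j"
    and "int (\<pi> n) - 2 * int n \<noteq> int (\<pi> j) - 2 * int j"
    and "2 * int (\<pi> n) - int n \<noteq> 2 * int (\<pi> j) - int j"
proof -
  have adm: "\<pi> n \<noteq> \<pi> j + (n - j)" "\<pi> n \<noteq> \<pi> j + 2 * (n - j)"
    "real (\<pi> n) \<noteq> real (\<pi> j) + real (n - j) / 2"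
    using admissible_\<pi>[of n] assms by auto
  show "int (\<pi> n) - int n \<noteq> int (\<pi> j) - int j"
    "int (\<pi> n) - 2 * int n \<noteq> int (\<pi> j) - 2 * int j"
    using adm(1,2) assms by linarith+
  show "2 * int (\<pi> n) - int n \<noteq> 2 * int (\<pi> j) - int j"
    using adm(3) assms by (auto simp: of_nat_diff field_simps)
qed

lemma inj_diff: "inj (\<lambda>n. int (\<pi> n) - int n)"
  and inj_diff2: "inj (\<lambda>n. int (\<pi> n) - 2 * int n)"
  and inj_half: "inj (\<lambda>n. 2 * int (\<pi> n) - int n)"
  by (rule linorder_injI, use \<pi>_neq in metis)+

lemma \<pi>_0 [simp]: "\<pi> 0 = 0"
  using not_admissible_less[of 0 0] by auto

text \<open>A positive fixed point would lie on the diagonal through \<open>(0, 0)\<close>.\<close>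

lemma \<pi>_fixed_iff: "\<pi> n = n \<longleftrightarrow> n = 0"
  using \<pi>_neq(1)[of 0 n] by (cases "n = 0") auto

definition lower :: "nat set" where
  "lower = \<pi> ` upper"

definition diff_set :: "nat set" where
  "diff_set = (\<lambda>x. \<pi> x - x) ` upper"

text \<open>These are the doubled offsets of the lines of slope 1/2 through the points
  \<open>(x, \<pi> x)\<close>. The subtraction does not truncate, since
  \<open>x \<le> \<pi> x\<close> on \<open>upper\<close>; the same holds for
  \<open>diff_set\<close>.\<close>

definition half_set :: "nat set" where
  "half_set = (\<lambda>x. 2 * \<pi> x - x) ` upper"

lemma inj_on_diff: "inj_on (\<lambda>x. \<pi> x - x) upper"
proof (rule inj_onI)
  fix x y assume "x \<in> upper" "y \<in> upper" "\<pi> x - x = \<pi> y - y"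
  then show "x = y"
    by (intro injD[OF inj_diff]) (auto simp: upper_def)
qed

lemma inj_on_half: "inj_on (\<lambda>x. 2 * \<pi> x - x) upper"
proof (rule inj_onI)
  fix x y assume "x \<in> upper" "y \<in> upper" "2 * \<pi> x - x = 2 * \<pi> y - y"
  then show "x = y"
    by (intro injD[OF inj_half]) (auto simp: upper_def)
qed

lemma upper_Un_lower: "upper \<union> lower = UNIV"
proof -
  have "n \<in> upper \<union> lower" for n
    by (cases "n \<le> \<pi> n") (auto simp: upper_def lower_def intro!: image_eqI[of _ _ "\<pi> n"])
  then show ?thesis by blast
qed

lemma upper_Int_lower: "upper \<inter> lower = {0}"
proof -
  have "x = 0" if "x \<in> upper" "x \<in> lower" for x
    using that \<pi>_fixed_iff[of x] by (auto simp: upper_def lower_def)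
  moreover have "0 \<in> upper" by (simp add: upper_def)
  moreover from this have "0 \<in> lower" unfolding lower_def by (intro image_eqI[of _ _ 0]) simp_all
  ultimately show ?thesis by blast
qed

section \<open>Counting functions and densities\<close>

definition count_le :: "nat set \<Rightarrow> real \<Rightarrow> real" where
  "count_le S z = real (card {s \<in> S. real s \<le> z})"

text \<open>Equivalent to \<open>count_le S z / z\<close> tending to \<open>\<delta>\<close>. The
  additive \<open>C\<close> absorbs any bounded range of \<open>z\<close>, so the estimates hold for
  all \<open>z \<ge> 0\<close> and combine linearly.\<close>

definition has_dens :: "nat set \<Rightarrow> real \<Rightarrow> bool" where
  "has_dens S \<delta> \<longleftrightarrow> (\<forall>\<eta>>0. \<exists>C. \<forall>z\<ge>0. \<bar>count_le S z - \<delta> * z\<bar> \<le> \<eta> * z + C)"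

lemma finite_le [simp]: "finite {s \<in> S. real s \<le> z}"
  by (rule finite_subset[of _ "{..nat \<lfloor>z\<rfloor>}"]) (auto simp: le_nat_floor)

lemma count_le_nonneg: "0 \<le> count_le S z"
  by (simp add: count_le_def)

lemma count_le_image:
  assumes "inj_on f S"
  shows "count_le (f ` S) z = real (card {x \<in> S. real (f x) \<le> z})"
proof -
  have "{s \<in> f ` S. real s \<le> z} = f ` {x \<in> S. real (f x) \<le> z}" by auto
  moreover have "inj_on f {x \<in> S. real (f x) \<le> z}"
    using assms by (rule inj_on_subset) auto
  ultimately show ?thesis by (simp add: count_le_def card_image)
qed

lemma count_le_UNIV: "0 \<le> z \<Longrightarrow> count_le UNIV z = real_of_int \<lfloor>z\<rfloor> + 1"
proof -
  assume "0 \<le> z"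
  then have "{s. real s \<le> z} = {..nat \<lfloor>z\<rfloor>}"
    by (simp add: set_eq_iff le_nat_iff le_floor_iff)
  with \<open>0 \<le> z\<close> show ?thesis by (simp add: count_le_def)
qed

lemma count_le_le: "0 \<le> z \<Longrightarrow> count_le S z \<le> z + 1"
proof -
  assume "0 \<le> z"
  have "count_le S z \<le> count_le UNIV z"
    unfolding count_le_def by (intro of_nat_mono card_mono finite_le) auto
  with count_le_UNIV[OF \<open>0 \<le> z\<close>] show ?thesis by linarith
qed

lemma count_upper_lower:
  assumes "0 \<le> z"
  shows "\<bar>count_le upper z + count_le lower z - z\<bar> \<le> 2"
proof -
  let ?A = "{s \<in> upper. real s \<le> z}" and ?B = "{s \<in> lower. real s \<le> z}"
  have "card ?A + card ?B = card (?A \<union> ?B) + card (?A \<inter> ?B)"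
    by (rule card_Un_Int) auto
  moreover have "?A \<union> ?B = {s \<in> upper \<union> lower. real s \<le> z}" by blast
  moreover have "?A \<inter> ?B = {s \<in> upper \<inter> lower. real s \<le> z}" by blast
  moreover have "{s \<in> upper \<inter> lower. real s \<le> z} = {0}"
    unfolding upper_Int_lower using assms by auto
  ultimately have "count_le upper z + count_le lower z = count_le UNIV z + 1"
    unfolding count_le_def upper_Un_lower by simp
  with count_le_UNIV[OF assms] show ?thesis by linarith
qed

lemma count_lower: "count_le lower z = real (card {x \<in> upper. real (\<pi> x) \<le> z})"
  unfolding lower_def by (intro count_le_image inj_on_subset[OF inj_\<pi>]) auto

lemma count_lower_le_upper: "count_le lower z \<le> count_le upper z"
  unfolding count_lower unfolding count_le_def
  by (intro of_nat_mono card_mono finite_le) (auto simp: upper_def)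

abbreviation window :: "nat set \<Rightarrow> real \<Rightarrow> real \<Rightarrow> nat set" where
  "window S u v \<equiv> {s \<in> S. u \<le> real s \<and> real s \<le> v}"

lemma finite_window [simp]: "finite (window S u v)"
  by (rule finite_subset[OF _ finite_le[of S v]]) auto

lemma card_window:
  assumes "0 \<le> u" "u \<le> v"
  shows "real (card (window S u v)) \<in>
    {count_le S v - count_le S u .. count_le S v - count_le S u + 1}"
proof -
  let ?W = "window S u v" and ?U = "{s \<in> S. real s \<le> u}" and ?V = "{s \<in> S. real s \<le> v}"
  have "card ?W + card ?U = card (?W \<union> ?U) + card (?W \<inter> ?U)"
    by (rule card_Un_Int) auto
  moreover have "?W \<union> ?U = ?V" using assms by auto
  \<comment> \<open>The window is closed on the left, so \<open>u\<close> is counted twice if it is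
    an element of \<open>S\<close>.\<close>
  moreover have "card (?W \<inter> ?U) \<le> 1"
  proof -
  have "?W \<inter> ?U \<subseteq> {nat \<lfloor>u\<rfloor>}"
    by (simp add: subset_iff) (metis antisym floor_of_nat nat_int)
  then show ?thesis
    using card_mono[of "{nat \<lfloor>u\<rfloor>}" "?W \<inter> ?U"] by simp
  qed
  ultimately show ?thesis by (auto simp: count_le_def)
qed

lemma has_dens_window:
  assumes "has_dens S \<delta>" "\<eta> > 0"
  shows "\<exists>C. \<forall>u v. 0 \<le> u \<longrightarrow> u \<le> v \<longrightarrow>
    \<bar>real (card (window S u v)) - \<delta> * (v - u)\<bar> \<le> \<eta> * v + C"
proof -
  obtain C where C: "\<And>z. z \<ge> 0 \<Longrightarrow> \<bar>count_le S z - \<delta> * z\<bar> \<le> \<eta> / 2 * z + C"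
    using assms unfolding has_dens_def by (metis half_gt_zero)
  have "\<bar>real (card (window S u v)) - \<delta> * (v - u)\<bar> \<le> \<eta> * v + (2 * C + 1)"
    if "0 \<le> u" "u \<le> v" for u v
  proof -
    have "\<eta> / 2 * u \<le> \<eta> / 2 * v" using that assms(2) by (intro mult_left_mono) auto
    then show ?thesis
      using card_window[of u v S] C[of u] C[of v] that unfolding right_diff_distrib by auto
  qed
  then show ?thesis by blast
qed

lemma finite_\<pi>_le [simp]: "finite {x \<in> upper. real (\<pi> x) \<le> r}"
  by (rule finite_subset[OF _ finite_le[of upper r]]) (auto simp: upper_def)

section \<open>Densities of images and a pigeonhole bound\<close>

text \<open>Since \<open>f x\<close> is about \<open>\<kappa> * \<pi> x\<close>, the condition
  \<open>f x \<le> z\<close> is squeezed between two conditions \<open>\<pi> x \<le> r\<close> with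
  \<open>r\<close> near \<open>z / \<kappa>\<close>, and these are counted by
  \<open>lower\<close>.\<close>

lemma has_dens_image:
  fixes f :: "nat \<Rightarrow> nat"
  assumes inj: "inj_on f upper" and "\<kappa> > 0" "\<delta> \<ge> 0"
    and near: "\<And>\<epsilon>. \<epsilon> > 0 \<Longrightarrow> \<exists>C. \<forall>x\<in>upper. \<bar>real (f x) - \<kappa> * real (\<pi> x)\<bar> \<le> \<epsilon> * real (\<pi> x) + C"
    and dens: "has_dens lower \<delta>"
  shows "has_dens (f ` upper) (\<delta> / \<kappa>)"
  unfolding has_dens_def
proof (intro allI impI)
  fix \<eta> :: real assume "\<eta> > 0"
  \<comment> \<open>One \<open>\<epsilon>\<close> serves both for the approximation of
    \<open>f\<close> and for the density of \<open>lower\<close>; continuity of the two quotients at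
    0 supplies one that changes the density by less than \<open>\<eta>\<close>.\<close>
  have up: "((\<lambda>\<epsilon>. (\<delta> + \<epsilon>) / (\<kappa> - \<epsilon>)) \<longlongrightarrow> (\<delta> + 0) / (\<kappa> - 0)) (at_right 0)"
    and lo: "((\<lambda>\<epsilon>. (\<delta> - \<epsilon>) / (\<kappa> + \<epsilon>)) \<longlongrightarrow> (\<delta> - 0) / (\<kappa> + 0)) (at_right 0)"
    using \<open>\<kappa> > 0\<close> by (intro tendsto_intros; simp)+
  have "\<forall>\<^sub>F \<epsilon> in at_right 0. 0 < \<epsilon> \<and> \<epsilon> < \<kappa> \<and>
      (\<delta> + \<epsilon>) / (\<kappa> - \<epsilon>) < \<delta> / \<kappa> + \<eta> \<and> \<delta> / \<kappa> - \<eta> < (\<delta> - \<epsilon>) / (\<kappa> + \<epsilon>)"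
    using order_tendstoD(2)[OF up, of "\<delta> / \<kappa> + \<eta>"] order_tendstoD(1)[OF lo, of "\<delta> / \<kappa> - \<eta>"]
      eventually_at_right_less[of "0::real"] eventually_at_right_real[OF \<open>\<kappa> > 0\<close>] \<open>\<eta> > 0\<close>
    by (auto elim!: eventually_elim2 simp: eventually_conj_iff)
  then obtain \<epsilon> where \<epsilon>: "0 < \<epsilon>" "\<epsilon> < \<kappa>"
      and eup: "(\<delta> + \<epsilon>) / (\<kappa> - \<epsilon>) < \<delta> / \<kappa> + \<eta>" and elo: "\<delta> / \<kappa> - \<eta> < (\<delta> - \<epsilon>) / (\<kappa> + \<epsilon>)"
    by (metis (mono_tags, lifting) eventually_happens trivial_limit_at_right_real)
  obtain C0 where "\<forall>x\<in>upper. \<bar>real (f x) - \<kappa> * real (\<pi> x)\<bar> \<le> \<epsilon> * real (\<pi> x) + C0"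
    using near \<epsilon> by blast
  then obtain C where "C \<ge> 0"
      and C: "\<And>x. x \<in> upper \<Longrightarrow> \<bar>real (f x) - \<kappa> * real (\<pi> x)\<bar> \<le> \<epsilon> * real (\<pi> x) + C"
    by (metis (no_types, opaque_lifting) add_left_mono max.cobounded1 max.cobounded2 order_trans)
  obtain C' where C': "\<And>z. z \<ge> 0 \<Longrightarrow> \<bar>count_le lower z - \<delta> * z\<bar> \<le> \<epsilon> * z + C'"
    using dens \<epsilon> unfolding has_dens_def by blast
  define q where "q = (\<delta> + \<epsilon>) / (\<kappa> - \<epsilon>)"
  define p where "p = (\<delta> - \<epsilon>) / (\<kappa> + \<epsilon>)"
  define K where "K = \<bar>C'\<bar> + q * C + \<bar>p\<bar> * C + \<delta> / \<kappa> * C"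
  have nonneg: "0 \<le> q * C" "0 \<le> \<bar>p\<bar> * C" "0 \<le> \<delta> / \<kappa> * C" "0 \<le> q"
    using \<epsilon> \<open>C \<ge> 0\<close> \<open>\<kappa> > 0\<close> \<open>\<delta> \<ge> 0\<close> by (auto simp: q_def)
  have "\<bar>count_le (f ` upper) z - \<delta> / \<kappa> * z\<bar> \<le> \<eta> * z + K" if "z \<ge> 0" for z
  proof -
    have eq: "count_le (f ` upper) z = real (card {x \<in> upper. real (f x) \<le> z})"
      by (rule count_le_image[OF inj])
    have sub: "{x \<in> upper. real (f x) \<le> z} \<subseteq> {x \<in> upper. real (\<pi> x) \<le> (z + C) / (\<kappa> - \<epsilon>)}"
    proof safe
      fix x assume "x \<in> upper" "real (f x) \<le> z"
      with C[of x] \<epsilon> show "real (\<pi> x) \<le> (z + C) / (\<kappa> - \<epsilon>)"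
        by (simp add: pos_le_divide_eq algebra_simps)
    qed
    have "count_le (f ` upper) z \<le> count_le lower ((z + C) / (\<kappa> - \<epsilon>))"
      unfolding eq count_lower by (intro of_nat_mono card_mono finite_\<pi>_le sub)
    also have "\<dots> \<le> (\<delta> + \<epsilon>) * ((z + C) / (\<kappa> - \<epsilon>)) + C'"
      using C'[of "(z + C) / (\<kappa> - \<epsilon>)"] that \<open>C \<ge> 0\<close> \<epsilon> unfolding distrib_right by fastforce
    also have "\<dots> = q * z + q * C + C'"
      unfolding q_def distrib_left[symmetric] by simp
    also have "q * z \<le> (\<delta> / \<kappa> + \<eta>) * z"
      using eup that by (intro mult_right_mono) (auto simp: q_def)
    finally have ub: "count_le (f ` upper) z - \<delta> / \<kappa> * z \<le> \<eta> * z + K"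
      using nonneg unfolding K_def distrib_right by linarith
    have "\<delta> / \<kappa> * z - \<eta> * z - K \<le> count_le (f ` upper) z"
    \<comment> \<open>For \<open>z < C\<close> the radius
      \<open>(z - C) / (\<kappa> + \<epsilon>)\<close> is negative; the term
      \<open>\<delta> / \<kappa> * C\<close> of \<open>K\<close> covers that range.\<close>
    proof (cases "C \<le> z")
      case True
      have sub': "{x \<in> upper. real (\<pi> x) \<le> (z - C) / (\<kappa> + \<epsilon>)} \<subseteq> {x \<in> upper. real (f x) \<le> z}"
      proof safe
        fix x assume "x \<in> upper" "real (\<pi> x) \<le> (z - C) / (\<kappa> + \<epsilon>)"
        with C[of x] \<epsilon> \<open>\<kappa> > 0\<close> show "real (f x) \<le> z"
          by (simp add: pos_le_divide_eq algebra_simps)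
      qed
      have "(\<delta> / \<kappa> - \<eta>) * z \<le> p * z"
        using elo that by (intro mult_right_mono) (auto simp: p_def)
      moreover have "p * C \<le> \<bar>p\<bar> * C"
        using \<open>C \<ge> 0\<close> by (intro mult_right_mono) auto
      moreover have "p * (z - C) - C' = (\<delta> - \<epsilon>) * ((z - C) / (\<kappa> + \<epsilon>)) - C'"
        by (simp add: p_def)
      moreover have "\<dots> \<le> count_le lower ((z - C) / (\<kappa> + \<epsilon>))"
        using C'[of "(z - C) / (\<kappa> + \<epsilon>)"] True \<epsilon> \<open>\<kappa> > 0\<close>
        unfolding left_diff_distrib[of \<delta>] by fastforce
      moreover have "\<dots> \<le> count_le (f ` upper) z"
        unfolding eq count_lower
        by (intro of_nat_mono card_mono sub' finite_subset[OF sub finite_\<pi>_le])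
      ultimately show ?thesis
        using nonneg unfolding K_def left_diff_distrib right_diff_distrib by linarith
    next
      case False
      then have "\<delta> / \<kappa> * z \<le> \<delta> / \<kappa> * C"
        using \<open>\<kappa> > 0\<close> \<open>\<delta> \<ge> 0\<close> by (intro mult_left_mono) auto
      moreover have "0 \<le> \<eta> * z" using \<open>\<eta> > 0\<close> that by simp
      ultimately show ?thesis
        using nonneg count_le_nonneg[of "f ` upper" z] unfolding K_def by linarith
    qed
    with ub show ?thesis by linarith
  qed
  then show "\<exists>C. \<forall>z\<ge>0. \<bar>count_le (f ` upper) z - \<delta> / \<kappa> * z\<bar> \<le> \<eta> * z + C"
    by blast
qed

text \<open>Pigeonhole: the \<open>x\<close> with \<open>w x \<le> z\<close> have distinct integers
  \<open>c x\<close> in an interval of length about \<open>\<bar>\<kappa>\<bar> * z\<close>.\<close>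

lemma count_bound_inj:
  fixes c :: "nat \<Rightarrow> int" and w :: "nat \<Rightarrow> nat"
  assumes inj: "inj c" and fin: "\<And>z. finite {x \<in> upper. real (w x) \<le> z}"
    and near: "\<And>\<epsilon>. \<epsilon> > 0 \<Longrightarrow> \<exists>C. \<forall>x\<in>upper. \<bar>real_of_int (c x) - \<kappa> * real (w x)\<bar> \<le> \<epsilon> * real (w x) + C"
    and count: "\<And>\<epsilon>. \<epsilon> > 0 \<Longrightarrow> \<exists>C. \<forall>z\<ge>0. (\<delta> - \<epsilon>) * z - C \<le> real (card {x \<in> upper. real (w x) \<le> z})"
  shows "\<delta> \<le> \<bar>\<kappa>\<bar>"
proof (rule field_le_epsilon)
  fix e :: real assume "e > 0"
  define \<epsilon> where "\<epsilon> = e / 4"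
  have "\<epsilon> > 0" using \<open>e > 0\<close> by (simp add: \<epsilon>_def)
  obtain C0 where C0: "\<And>x. x \<in> upper \<Longrightarrow> \<bar>real_of_int (c x) - \<kappa> * real (w x)\<bar> \<le> \<epsilon> * real (w x) + C0"
    using near \<open>\<epsilon> > 0\<close> by blast
  obtain C1 where C1: "\<And>z. z \<ge> 0 \<Longrightarrow> (\<delta> - \<epsilon>) * z - C1 \<le> real (card {x \<in> upper. real (w x) \<le> z})"
    using count \<open>\<epsilon> > 0\<close> by blast
  define C where "C = \<bar>C0\<bar> + 1"
  have lin: "(\<delta> - \<bar>\<kappa>\<bar> - e) * z \<le> C1 + 2 * C + 2" if "z \<ge> 0" for z
  proof -
    let ?S = "{x \<in> upper. real (w x) \<le> z}"
    \<comment> \<open>The interval is from \<open>- m\<close> to \<open>M\<close>. The sign of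
      \<open>\<kappa>\<close> decides which end carries the main term, so \<open>M + m\<close> has
      leading coefficient \<open>\<bar>\<kappa>\<bar> + 2 * \<epsilon>\<close>.\<close>
    define m where "m = (max (- \<kappa>) 0 + \<epsilon>) * z + C"
    define M where "M = (max \<kappa> 0 + \<epsilon>) * z + C"
    have "m \<ge> 0" "M \<ge> 0" using \<open>\<epsilon> > 0\<close> that by (auto simp: m_def M_def C_def)
    have "c ` ?S \<subseteq> {- \<lfloor>m\<rfloor> .. \<lfloor>M\<rfloor>}"
    proof (clarsimp, intro conjI)
      fix x assume x: "x \<in> upper" "real (w x) \<le> z"
      have "\<epsilon> * real (w x) \<le> \<epsilon> * z" using x \<open>\<epsilon> > 0\<close> by simp
      moreover have "\<kappa> * real (w x) \<le> max \<kappa> 0 * z" "(- \<kappa>) * real (w x) \<le> max (- \<kappa>) 0 * z"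
        using x that by (intro mult_mono; simp)+
      ultimately have "real_of_int (c x) \<le> M" "real_of_int (- c x) \<le> m"
        using C0[OF x(1)] unfolding m_def M_def C_def distrib_right by auto
      then have "- c x \<le> \<lfloor>m\<rfloor>" "c x \<le> \<lfloor>M\<rfloor>" by (simp_all add: le_floor_iff)
      then show "- \<lfloor>m\<rfloor> \<le> c x" "c x \<le> \<lfloor>M\<rfloor>" by linarith+
    qed
    then have "card (c ` ?S) \<le> card {- \<lfloor>m\<rfloor> .. \<lfloor>M\<rfloor>}" by (intro card_mono) auto
    moreover have "card (c ` ?S) = card ?S"
      by (intro card_image inj_on_subset[OF inj]) auto
    ultimately have "real (card ?S) \<le> real (card {- \<lfloor>m\<rfloor> .. \<lfloor>M\<rfloor>})" by simp
    also have "\<dots> \<le> M + m + 1" using \<open>m \<ge> 0\<close> \<open>M \<ge> 0\<close> by simp linarith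
    also have "\<dots> = (\<bar>\<kappa>\<bar> + 2 * \<epsilon>) * z + 2 * C + 1"
      by (auto simp: M_def m_def max_def algebra_simps abs_if)
    finally have "(\<delta> - \<epsilon>) * z - C1 \<le> (\<bar>\<kappa>\<bar> + 2 * \<epsilon>) * z + 2 * C + 1"
      using C1[OF that] by linarith
    moreover have "e * z = 4 * (\<epsilon> * z)" "0 \<le> \<epsilon> * z" using \<open>\<epsilon> > 0\<close> that by (auto simp: \<epsilon>_def)
    ultimately show ?thesis unfolding left_diff_distrib distrib_right by linarith
  qed
  show "\<delta> \<le> \<bar>\<kappa>\<bar> + e"
  proof (rule ccontr)
    assume "\<not> \<delta> \<le> \<bar>\<kappa>\<bar> + e"
    then have pos: "\<delta> - \<bar>\<kappa>\<bar> - e > 0" by simp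
    then obtain n :: nat where "C1 + 2 * C + 2 < real n * (\<delta> - \<bar>\<kappa>\<bar> - e)"
      using reals_Archimedean3 by blast
    with lin[of "real n"] show False by (simp add: mult.commute)
  qed
qed

section \<open>Densities forced by a limiting slope\<close>

text \<open>Encodes that \<open>x / \<pi> x\<close> tends to \<open>\<beta>\<close> along
  \<open>upper\<close>, without dividing by \<open>\<pi> 0 = 0\<close>; \<open>C\<close> absorbs
  finitely many exceptions.\<close>

definition upper_slope :: "real \<Rightarrow> bool" where
  "upper_slope \<beta> \<longleftrightarrow> (\<forall>\<epsilon>>0. \<exists>C. \<forall>x\<in>upper. \<bar>real x - \<beta> * real (\<pi> x)\<bar> \<le> \<epsilon> * real (\<pi> x) + C)"

lemma upper_slopeE:
  assumes "upper_slope \<beta>" "\<epsilon> > 0"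
  obtains C where "C \<ge> 1" "\<And>x. x \<in> upper \<Longrightarrow> \<bar>real x - \<beta> * real (\<pi> x)\<bar> \<le> \<epsilon> * real (\<pi> x) + C"
proof -
  obtain C where C: "\<And>x. x \<in> upper \<Longrightarrow> \<bar>real x - \<beta> * real (\<pi> x)\<bar> \<le> \<epsilon> * real (\<pi> x) + C"
    using assms unfolding upper_slope_def by blast
  have "\<bar>real x - \<beta> * real (\<pi> x)\<bar> \<le> \<epsilon> * real (\<pi> x) + max 1 C" if "x \<in> upper" for x
    using C[OF that] by linarith
  then show ?thesis by (intro that[of "max 1 C"]) auto
qed

text \<open>
  The map \<open>x \<mapsto> \<pi> x\<close> stretches \<open>upper\<close> onto \<open>lower\<close> by the factor \<open>1 / \<beta>\<close>, and the two sets
  are complementary; hence an error \<open>c\<close> in the density of \<open>upper\<close> becomes an error \<open>\<beta> * c\<close>.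
\<close>
lemma upper_dens_step:
  assumes "upper_slope \<beta>" "0 \<le> \<beta>" "\<beta> \<le> 1" "0 \<le> c" "c \<le> 2" "\<epsilon> > 0"
    and bound: "\<exists>C. \<forall>z\<ge>0. \<bar>count_le upper z - 1 / (1 + \<beta>) * z\<bar> \<le> c * z + C"
  shows "\<exists>C. \<forall>z\<ge>0. \<bar>count_le upper z - 1 / (1 + \<beta>) * z\<bar> \<le> (\<beta> * c + \<epsilon>) * z + C"
proof -
  define \<rho> where "\<rho> = 1 / (1 + \<beta>)"
  \<comment> \<open>If \<open>upper\<close> has density \<open>r\<close>, then \<open>lower\<close>
    has density \<open>\<beta> * r\<close>, and the two add up to 1; \<open>\<rho>\<close> is the
    solution of \<open>r = 1 - \<beta> * r\<close>, which makes the main terms cancel.\<close>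
  have \<rho>: "0 \<le> \<rho>" "\<rho> \<le> 1" "\<rho> * \<beta> = 1 - \<rho>"
    using assms by (auto simp: \<rho>_def field_simps)
  define e where "e = \<epsilon> / 4"
  have "e > 0" using assms by (simp add: e_def)
  obtain C where "C \<ge> 1"
      and C: "\<And>x. x \<in> upper \<Longrightarrow> \<bar>real x - \<beta> * real (\<pi> x)\<bar> \<le> e * real (\<pi> x) + C"
    using upper_slopeE[OF assms(1) \<open>e > 0\<close>] by blast
  obtain C0 where C0: "\<And>z. z \<ge> 0 \<Longrightarrow> \<bar>count_le upper z - \<rho> * z\<bar> \<le> c * z + C0"
    using bound unfolding \<rho>_def by blast
  define K where "K = 3 * C + \<bar>C0\<bar> + 2"
  have "\<bar>count_le upper z - \<rho> * z\<bar> \<le> (\<beta> * c + \<epsilon>) * z + K" if "z \<ge> 0" for z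
  proof -
    have ez: "0 \<le> e * z" using \<open>e > 0\<close> that by simp
    have cz: "0 \<le> (\<beta> * c) * z" using assms that by simp
    have "{x \<in> upper. real (\<pi> x) \<le> z} \<subseteq> {x \<in> upper. real x \<le> (\<beta> + e) * z + C}"
    proof safe
      fix x assume x: "x \<in> upper" "real (\<pi> x) \<le> z"
      then have "(\<beta> + e) * real (\<pi> x) \<le> (\<beta> + e) * z"
        using \<open>e > 0\<close> assms by (intro mult_left_mono) auto
      then show "real x \<le> (\<beta> + e) * z + C"
        using C[OF x(1)] unfolding distrib_right by linarith
    qed
    then have "count_le lower z \<le> count_le upper ((\<beta> + e) * z + C)"
      unfolding count_lower unfolding count_le_def by (intro of_nat_mono card_mono finite_le)
    also have "\<dots> \<le> (\<rho> + c) * ((\<beta> + e) * z + C) + C0"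
      using C0[of "(\<beta> + e) * z + C"] that assms \<open>e > 0\<close> \<open>C \<ge> 1\<close> unfolding distrib_right[of \<rho>] by fastforce
    also have "\<dots> = (\<rho> * \<beta>) * z + (\<beta> * c) * z + (\<rho> + c) * (e * z) + (\<rho> + c) * C + C0"
      by (simp add: algebra_simps)
    also have "(\<rho> + c) * (e * z) \<le> 3 * (e * z)"
      using ez \<rho> assms by (intro mult_right_mono) auto
    also have "(\<rho> + c) * C \<le> 3 * C"
      using \<open>C \<ge> 1\<close> \<rho> assms by (intro mult_right_mono) auto
    finally have ub: "count_le lower z \<le> (1 - \<rho>) * z + (\<beta> * c) * z + 3 * (e * z) + 3 * C + C0"
      unfolding \<rho>(3) by simp
    have lb: "(1 - \<rho>) * z - (\<beta> * c) * z - 3 * (e * z) - 3 * C - \<bar>C0\<bar> \<le> count_le lower z"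
    \<comment> \<open>For such \<open>z\<close>, which means all \<open>z\<close> if
      \<open>\<beta> \<le> e\<close>, the left-hand side is not positive. Otherwise
      \<open>\<beta> > e\<close>, and dividing by \<open>\<beta> - e\<close> is legitimate.\<close>
    proof (cases "(\<beta> - e) * z < C")
      case True
      have "(\<rho> * \<beta>) * z \<le> \<beta> * z"
        using \<rho> assms that by (intro mult_right_mono mult_left_le_one_le) auto
      with True show ?thesis
        using count_le_nonneg[of lower z] ez cz \<open>C \<ge> 1\<close> unfolding \<rho>(3) left_diff_distrib by linarith
    next
      case False
      then have "(\<beta> - e) * z > 0" using \<open>C \<ge> 1\<close> by linarith
      then have "\<beta> > e" using that by (simp add: zero_less_mult_iff)
      let ?r = "(\<beta> - e) * z - C"
      have "{x \<in> upper. real x \<le> ?r} \<subseteq> {x \<in> upper. real (\<pi> x) \<le> z}"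
      proof safe
        fix x assume x: "x \<in> upper" "real x \<le> ?r"
        then have "(\<beta> - e) * real (\<pi> x) \<le> (\<beta> - e) * z"
          using C[OF x(1)] unfolding left_diff_distrib by linarith
        then show "real (\<pi> x) \<le> z" using \<open>\<beta> > e\<close> by simp
      qed
      then have "count_le upper ?r \<le> count_le lower z"
        unfolding count_lower unfolding count_le_def by (intro of_nat_mono card_mono finite_\<pi>_le)
      moreover have "(\<rho> - c) * ?r - C0 \<le> count_le upper ?r"
        using C0[of ?r] False unfolding left_diff_distrib[of \<rho>] by fastforce
      moreover have "(\<rho> - c) * ?r = (\<rho> * \<beta>) * z - (\<beta> * c) * z - (\<rho> - c) * (e * z) - (\<rho> - c) * C"
        by (simp add: algebra_simps)
      moreover have "(\<rho> - c) * (e * z) \<le> 1 * (e * z)"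
        using ez \<rho> assms by (intro mult_right_mono) auto
      moreover have "(\<rho> - c) * C \<le> 1 * C"
        using \<open>C \<ge> 1\<close> \<rho> assms by (intro mult_right_mono) auto
      ultimately show ?thesis
        using ez \<open>C \<ge> 1\<close> unfolding \<rho>(3) by linarith
    qed
    have "\<epsilon> * z = 4 * (e * z)" by (simp add: e_def)
    then show ?thesis
      using ub lb count_upper_lower[OF that] ez unfolding K_def distrib_right left_diff_distrib by linarith
  qed
  then show ?thesis unfolding \<rho>_def by blast
qed

text \<open>Iterating \<open>upper_dens_step\<close> from the trivial error 1 shrinks the error to
  \<open>\<beta> ^ n\<close> up to \<open>\<epsilon>\<close>, and \<open>\<beta> < 1\<close> drives
  this to 0.\<close>

lemma upper_dens:
  assumes "upper_slope \<beta>" "0 \<le> \<beta>" "\<beta> < 1"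
  shows "has_dens upper (1 / (1 + \<beta>))"
proof -
  have iter: "\<exists>C. \<forall>z\<ge>0. \<bar>count_le upper z - 1 / (1 + \<beta>) * z\<bar> \<le> (\<beta> ^ n + \<epsilon>) * z + C" if "\<epsilon> > 0" for n \<epsilon>
    using that
  proof (induction n arbitrary: \<epsilon>)
    case 0
    have "\<bar>count_le upper z - 1 / (1 + \<beta>) * z\<bar> \<le> (\<beta> ^ 0 + \<epsilon>) * z + 1" if "z \<ge> 0" for z
    proof -
      have "0 \<le> 1 / (1 + \<beta>) * z" "1 / (1 + \<beta>) * z \<le> 1 * z" "0 \<le> \<epsilon> * z"
        using assms that 0 by (auto intro!: mult_right_mono simp: field_simps)
      then show ?thesis
        using count_le_le[OF that, of upper] count_le_nonneg[of upper z] by (simp add: distrib_right)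
    qed
    then show ?case by blast
  next
    case (Suc n)
    \<comment> \<open>The cap at 1 keeps the error \<open>\<beta> ^ n + ?e\<close> within the bound
      2 that \<open>upper_dens_step\<close> asks for.\<close>
    let ?e = "min 1 (\<epsilon> / 2)"
    have "\<beta> ^ n \<le> 1" "0 \<le> \<beta> ^ n" using assms by (auto simp: power_le_one)
    then have "\<exists>C. \<forall>z\<ge>0. \<bar>count_le upper z - 1 / (1 + \<beta>) * z\<bar> \<le> (\<beta> * (\<beta> ^ n + ?e) + \<epsilon> / 2) * z + C"
      using assms Suc by (intro upper_dens_step Suc.IH) auto
    moreover have "\<beta> * (\<beta> ^ n + ?e) + \<epsilon> / 2 \<le> \<beta> ^ Suc n + \<epsilon>"
      using mult_left_le_one_le[of ?e \<beta>] assms Suc.prems by (simp add: distrib_left)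
    ultimately show ?case
      by (meson add_right_mono mult_right_mono order_trans)
  qed
  show ?thesis unfolding has_dens_def
  proof (intro allI impI)
    fix \<eta> :: real assume "\<eta> > 0"
    then obtain n where "\<beta> ^ n < \<eta> / 2"
      using real_arch_pow_inv[of "\<eta> / 2" \<beta>] assms by auto
    then have "\<beta> ^ n + \<eta> / 2 \<le> \<eta>" by simp
    with iter[of "\<eta> / 2" n] \<open>\<eta> > 0\<close>
    show "\<exists>C. \<forall>z\<ge>0. \<bar>count_le upper z - 1 / (1 + \<beta>) * z\<bar> \<le> \<eta> * z + C"
      by (meson add_right_mono half_gt_zero mult_right_mono order_trans)
  qed
qed

lemma lower_dens:
  assumes "upper_slope \<beta>" "0 \<le> \<beta>" "\<beta> < 1"
  shows "has_dens lower (\<beta> / (1 + \<beta>))"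
  unfolding has_dens_def
proof (intro allI impI)
  fix \<eta> :: real assume "\<eta> > 0"
  then obtain C where C: "\<And>z. z \<ge> 0 \<Longrightarrow> \<bar>count_le upper z - 1 / (1 + \<beta>) * z\<bar> \<le> \<eta> * z + C"
    using upper_dens[OF assms] unfolding has_dens_def by blast
  have "\<beta> / (1 + \<beta>) = 1 - 1 / (1 + \<beta>)" using assms by (simp add: field_simps)
  then have "\<bar>count_le lower z - \<beta> / (1 + \<beta>) * z\<bar> \<le> \<eta> * z + (C + 2)" if "z \<ge> 0" for z
    using C[OF that] count_upper_lower[OF that] by (simp add: left_diff_distrib)
  then show "\<exists>C. \<forall>z\<ge>0. \<bar>count_le lower z - \<beta> / (1 + \<beta>) * z\<bar> \<le> \<eta> * z + C" by blast
qed

section \<open>Upper bounds on the slope\<close>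

text \<open>At slope 1 the iteration does not contract. Still, \<open>lower\<close> is never ahead
  of \<open>upper\<close>, so \<open>upper\<close> has lower density at least 1/2, while slope 1
  would squeeze the distinct differences \<open>\<pi> x - x\<close> into an interval of sublinear
  length.\<close>

lemma upper_slope_neq_1: "\<not> upper_slope 1"
proof
  assume slope: "upper_slope 1"
  have "1 / 2 \<le> \<bar>0::real\<bar>"
  proof (rule count_bound_inj[OF inj_diff, where w = "\<lambda>x. x"])
    show "finite {x \<in> upper. real x \<le> z}" for z by (rule finite_le)
  next
    fix \<epsilon> :: real assume "\<epsilon> > 0"
    \<comment> \<open>With \<open>e \<le> 1 / 2\<close>, an error relative to \<open>\<pi> x\<close>
      becomes one relative to \<open>x\<close> at the price of a factor 2.\<close>
    define e where "e = min (1 / 2) (\<epsilon> / 2)"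
    have e: "0 < e" "e \<le> 1 / 2" "2 * e \<le> \<epsilon>" using \<open>\<epsilon> > 0\<close> by (auto simp: e_def)
    obtain C where C: "\<And>x. x \<in> upper \<Longrightarrow> \<bar>real x - 1 * real (\<pi> x)\<bar> \<le> e * real (\<pi> x) + C"
      using upper_slopeE[OF slope \<open>0 < e\<close>] by blast
    have "\<bar>real_of_int (int (\<pi> x) - int x) - 0 * real x\<bar> \<le> \<epsilon> * real x + 2 * C" if "x \<in> upper" for x
    proof -
      have le: "real x \<le> real (\<pi> x)" using that by (simp add: upper_def)
      have "e * (real (\<pi> x) - real x) \<le> 1 / 2 * (real (\<pi> x) - real x)"
        using e le by (intro mult_right_mono) auto
      moreover have "(2 * e) * real x \<le> \<epsilon> * real x" using e by (intro mult_right_mono) auto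
      ultimately show ?thesis
        using C[OF that] le unfolding right_diff_distrib by (simp add: abs_le_iff)
    qed
    then show "\<exists>C. \<forall>x\<in>upper. \<bar>real_of_int (int (\<pi> x) - int x) - 0 * real x\<bar> \<le> \<epsilon> * real x + C"
      by blast
  next
    fix \<epsilon> :: real assume "\<epsilon> > 0"
    have "(1 / 2 - \<epsilon>) * z - 1 \<le> real (card {x \<in> upper. real x \<le> z})" if "z \<ge> 0" for z
    proof -
      have "0 \<le> \<epsilon> * z" using that \<open>\<epsilon> > 0\<close> by simp
      then show ?thesis
        using count_upper_lower[OF that] count_lower_le_upper[of z]
        unfolding count_le_def[symmetric] left_diff_distrib by linarith
    qed
    then show "\<exists>C. \<forall>z\<ge>0. (1 / 2 - \<epsilon>) * z - C \<le> real (card {x \<in> upper. real x \<le> z})"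
      by blast
  qed
  then show False by simp
qed

text \<open>Pigeonhole with the points ordered by \<open>\<pi> x\<close>, so that their number is
  the counting function of \<open>lower\<close>. The factor \<open>q\<close> measures how strongly
  the slope error enters the offset \<open>c x\<close>.\<close>

lemma lower_dens_bound_inj:
  fixes c :: "nat \<Rightarrow> int"
  assumes slope: "upper_slope \<beta>" "0 \<le> \<beta>" "\<beta> < 1" and "inj c" and "q > 0"
    and near: "\<And>x. \<bar>real_of_int (c x) - \<kappa> * real (\<pi> x)\<bar> \<le> q * \<bar>real x - \<beta> * real (\<pi> x)\<bar>"
  shows "\<beta> / (1 + \<beta>) \<le> \<bar>\<kappa>\<bar>"
proof (rule count_bound_inj[OF \<open>inj c\<close>, where w = \<pi>])
  show "finite {x \<in> upper. real (\<pi> x) \<le> z}" for z by (rule finite_\<pi>_le)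
next
  fix \<epsilon> :: real assume "\<epsilon> > 0"
  then obtain C where C: "\<And>x. x \<in> upper \<Longrightarrow> \<bar>real x - \<beta> * real (\<pi> x)\<bar> \<le> \<epsilon> / q * real (\<pi> x) + C"
    using upper_slopeE[OF slope(1), of "\<epsilon> / q"] \<open>q > 0\<close> by (metis divide_pos_pos)
  have "\<bar>real_of_int (c x) - \<kappa> * real (\<pi> x)\<bar> \<le> \<epsilon> * real (\<pi> x) + q * C" if "x \<in> upper" for x
  proof -
    have "q * \<bar>real x - \<beta> * real (\<pi> x)\<bar> \<le> q * (\<epsilon> / q * real (\<pi> x) + C)"
      using C[OF that] \<open>q > 0\<close> by (intro mult_left_mono) auto
    with near[of x] \<open>q > 0\<close> show ?thesis by (simp add: distrib_left)
  qed
  then show "\<exists>C. \<forall>x\<in>upper. \<bar>real_of_int (c x) - \<kappa> * real (\<pi> x)\<bar> \<le> \<epsilon> * real (\<pi> x) + C"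
    by blast
next
  fix \<epsilon> :: real assume "\<epsilon> > 0"
  then obtain C where C: "\<And>z. z \<ge> 0 \<Longrightarrow> \<bar>count_le lower z - \<beta> / (1 + \<beta>) * z\<bar> \<le> \<epsilon> * z + C"
    using lower_dens[OF slope] unfolding has_dens_def by blast
  have "(\<beta> / (1 + \<beta>) - \<epsilon>) * z - C \<le> real (card {x \<in> upper. real (\<pi> x) \<le> z})" if "z \<ge> 0" for z
    using C[OF that] unfolding count_lower[symmetric] left_diff_distrib by linarith
  then show "\<exists>C. \<forall>z\<ge>0. (\<beta> / (1 + \<beta>) - \<epsilon>) * z - C \<le> real (card {x \<in> upper. real (\<pi> x) \<le> z})"
    by blast
qed

text \<open>The pigeonhole bound is applied to the offsets of slope 1, with
  \<open>\<kappa> = 1 - \<beta>\<close>, and of slope 2, with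
  \<open>\<kappa> = 1 - 2 * \<beta>\<close>. The former rules out the branch
  \<open>\<beta> \<ge> 1 / 2\<close> of the latter.\<close>

lemma slope_bound:
  assumes slope: "upper_slope \<beta>" "0 \<le> \<beta>" "\<beta> < 1"
  shows "2 * \<beta>\<^sup>2 + 2 * \<beta> \<le> 1" "\<beta> < 1 / 2"
proof -
  have "\<beta> / (1 + \<beta>) \<le> \<bar>1 - \<beta>\<bar>"
    by (rule lower_dens_bound_inj[OF slope inj_diff, where q = 1])
      (auto simp: left_diff_distrib)
  then have "\<beta> \<le> (1 - \<beta>) * (1 + \<beta>)"
    using assms by (simp add: pos_divide_le_eq)
  then have 1: "\<beta>\<^sup>2 + \<beta> \<le> 1" by (simp add: power2_eq_square algebra_simps)
  have "\<beta> / (1 + \<beta>) \<le> \<bar>1 - 2 * \<beta>\<bar>"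
    by (rule lower_dens_bound_inj[OF slope inj_diff2, where q = 2])
      (simp_all add: left_diff_distrib abs_if)
  then have 2: "\<beta> \<le> \<bar>1 - 2 * \<beta>\<bar> * (1 + \<beta>)"
    using assms by (simp add: pos_divide_le_eq)
  show half: "\<beta> < 1 / 2"
  proof (rule ccontr)
    assume "\<not> \<beta> < 1 / 2"
    \<comment> \<open>On this branch slope 2 gives \<open>2 * \<beta>\<^sup>2 \<ge> 1\<close>,
      whereas slope 1 gives \<open>\<beta>\<^sup>2 \<le> 1 - \<beta> \<le> 1 / 2\<close>. Equality
      would force \<open>\<beta> = 1 / 2\<close>, whose square is only 1/4.\<close>
    then have "\<beta> \<le> (2 * \<beta> - 1) * (1 + \<beta>)" and "1 / 4 \<le> (\<beta> - 1 / 2) + 1 / 4" using 2 by auto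
    then have "1 \<le> 2 * \<beta>\<^sup>2" by (simp add: power2_eq_square algebra_simps)
    with 1 \<open>\<not> \<beta> < 1 / 2\<close> have "\<beta> = 1 / 2" by linarith
    with \<open>1 \<le> 2 * \<beta>\<^sup>2\<close> show False by (simp add: power2_eq_square)
  qed
  with 2 show "2 * \<beta>\<^sup>2 + 2 * \<beta> \<le> 1" by (simp add: power2_eq_square algebra_simps)
qed

section \<open>Lines covering a column of the sector\<close>

text \<open>A limiting slope below 1/2 leaves a gap. With \<open>e\<close> half of that gap, each
  exception satisfies \<open>e * \<pi> x \<le> C\<close>.\<close>

lemma finite_shallow:
  assumes "upper_slope \<beta>" "\<beta> < 1 / 2"
  shows "finite {x \<in> upper. \<pi> x < 2 * x}"
proof -
  define e where "e = (1 / 2 - \<beta>) / 2"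
  have "e > 0" using assms by (simp add: e_def)
  then obtain C where C: "\<And>x. x \<in> upper \<Longrightarrow> \<bar>real x - \<beta> * real (\<pi> x)\<bar> \<le> e * real (\<pi> x) + C"
    using upper_slopeE[OF assms(1)] by blast
  have "{x \<in> upper. \<pi> x < 2 * x} \<subseteq> {x \<in> upper. real (\<pi> x) \<le> C / e}"
  proof safe
    fix x assume x: "x \<in> upper" "\<pi> x < 2 * x"
    have "1 / 2 * real (\<pi> x) - \<beta> * real (\<pi> x) - e * real (\<pi> x) = e * real (\<pi> x)"
      by (simp add: e_def field_simps)
    moreover have "1 / 2 * real (\<pi> x) \<le> real x" using x by simp
    ultimately have "e * real (\<pi> x) \<le> C" using C[OF x(1)] by linarith
    with \<open>e > 0\<close> show "real (\<pi> x) \<le> C / e" by (simp add: pos_le_divide_eq mult.commute)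
  qed
  then show ?thesis by (rule finite_subset) (rule finite_\<pi>_le)
qed

text \<open>
  Below the beam every position \<open>(x, y)\<close> with \<open>x \<le> y < 2 * x\<close> must see an earlier P-position.  The
  lines of slope 2 through the reflected points and the lines of slope 1/2 through the upper points
  have the same offsets \<open>2 * \<pi> j - j\<close>; the last set is a bounded number of exceptions.
\<close>
lemma below_cover:
  assumes "x \<in> upper" "2 * x \<le> \<pi> x" "x \<le> y" "y < 2 * x"
  shows "y \<in> lower \<or> y - x \<in> diff_set \<or> 2 * x - y \<in> half_set \<or> 2 * y - x \<in> half_set \<or>
    y \<in> (\<lambda>j. 2 * x + \<pi> j - 2 * j) ` {j \<in> upper. \<pi> j < 2 * j}"
proof -
  have "\<not> admissible x y" using assms by (intro not_admissible_less) auto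
  then obtain j where "j < x" and
    "y = \<pi> j \<or> y = \<pi> j + (x - j) \<or> y = \<pi> j + 2 * (x - j) \<or> real y = real (\<pi> j) + real (x - j) / 2"
    by blast
  moreover have "real y = real (\<pi> j) + real (x - j) / 2 \<longleftrightarrow> 2 * y + j = 2 * \<pi> j + x"
    using \<open>j < x\<close> by (simp add: of_nat_diff field_simps) linarith
  ultimately consider "y = \<pi> j" | "y = \<pi> j + (x - j)" | "y = \<pi> j + 2 * (x - j)"
    | "2 * y + j = 2 * \<pi> j + x"
    by blast
  note hit = this
  show ?thesis
  proof (cases "j \<in> upper")
    case True
    then have "j \<le> \<pi> j" by (simp add: upper_def)
    show ?thesis
    proof (cases rule: hit)
      case 1
      with True show ?thesis by (auto simp: lower_def)
    next
      case 2
      then have "y - x = \<pi> j - j" using \<open>j \<le> \<pi> j\<close> \<open>j < x\<close> by simp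
      with True show ?thesis by (auto simp: diff_set_def)
    next
      case 3
      \<comment> \<open>A line of slope 2 preserves \<open>y - 2 * x\<close>, so it reaches the
        sector only from a point with \<open>\<pi> j < 2 * j\<close>.\<close>
      then have "y = 2 * x + \<pi> j - 2 * j" "\<pi> j < 2 * j" using \<open>j < x\<close> assms by auto
      with True show ?thesis by blast
    next
      case 4
      then have "2 * y - x = 2 * \<pi> j - j" by simp
      with True show ?thesis by (auto simp: half_set_def)
    qed
  next
    case False
    \<comment> \<open>Now \<open>(j, \<pi> j)\<close> is the mirror image of the upper point
      \<open>(i, \<pi> i)\<close>. From below the diagonal only a line of slope 2 can enter the
      interior of the sector; its offset \<open>2 * j - i\<close> is
      \<open>2 * \<pi> i - i\<close>.\<close>
    define i where "i = \<pi> j"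
    have i: "\<pi> i = j" "\<pi> j = i" "i \<le> j" "i \<in> upper"
      using False by (auto simp: i_def upper_def)
    show ?thesis
    proof (cases rule: hit)
      case 1
      with i \<open>j < x\<close> assms show ?thesis by simp
    next
      case 2
      with i \<open>j < x\<close> assms have "y = x" by linarith
      moreover have "0 \<in> diff_set" by (auto simp: diff_set_def upper_def intro!: image_eqI[of _ _ 0])
      ultimately show ?thesis by simp
    next
      case 3
      then have "2 * x - y = 2 * \<pi> i - i" using i \<open>j < x\<close> by simp
      with i(4) show ?thesis by (auto simp: half_set_def)
    next
      case 4
      with i \<open>j < x\<close> assms show ?thesis by linarith
    qed
  qed
qed

text \<open>The column has \<open>x\<close> points in the sector, covered by five families of lines.
  A union bound adds their sizes, but horizontal lines and diagonals go through inclusion-exclusion,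
  which keeps their common points on the left.\<close>

lemma cover_count:
  assumes "x \<in> upper" "2 * x \<le> \<pi> x" and fin: "finite {j \<in> upper. \<pi> j < 2 * j}"
  shows "x + card {y \<in> lower. x \<le> y \<and> y < 2 * x \<and> y - x \<in> diff_set} \<le>
    card {s \<in> lower. x \<le> s \<and> s < 2 * x} + card {s \<in> diff_set. s < x} + card {s \<in> half_set. s \<le> x}
    + card {s \<in> half_set. x \<le> s \<and> s < 3 * x \<and> even (s + x)} + card {j \<in> upper. \<pi> j < 2 * j}"
proof -
  \<comment> \<open>Heights at which column \<open>x\<close> is met by horizontal lines
    (\<open>P\<close>), diagonals (\<open>Q\<close>), lines of slope 2 through reflected points
    (\<open>R\<close>), lines of slope 1/2 (\<open>S\<close>) and exceptional lines of slope 2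
    (\<open>T\<close>). In \<open>S\<close> the offset is \<open>s = 2 * y - x\<close>, whence its
    range and parity.\<close>
  define P where "P = {s \<in> lower. x \<le> s \<and> s < 2 * x}"
  define Q where "Q = (\<lambda>s. s + x) ` {s \<in> diff_set. s < x}"
  define R where "R = (\<lambda>s. 2 * x - s) ` {s \<in> half_set. s \<le> x}"
  define S where "S = (\<lambda>s. (s + x) div 2) ` {s \<in> half_set. x \<le> s \<and> s < 3 * x \<and> even (s + x)}"
  define T where "T = (\<lambda>j. 2 * x + \<pi> j - 2 * j) ` {j \<in> upper. \<pi> j < 2 * j}"
  have finS: "finite {s \<in> half_set. x \<le> s \<and> s < 3 * x \<and> even (s + x)}"
    by (rule finite_subset[of _ "{..<3 * x}"]) auto
  have "finite P" "finite Q" "finite R" "finite S" "finite T"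
    using fin finS by (auto simp: P_def Q_def R_def S_def T_def)
  have card: "card Q \<le> card {s \<in> diff_set. s < x}" "card R \<le> card {s \<in> half_set. s \<le> x}"
    "card S \<le> card {s \<in> half_set. x \<le> s \<and> s < 3 * x \<and> even (s + x)}"
    "card T \<le> card {j \<in> upper. \<pi> j < 2 * j}"
    unfolding Q_def R_def S_def T_def by (intro card_image_le; use fin finS in simp)+
  have "{x..<2 * x} \<subseteq> (P \<union> Q) \<union> R \<union> S \<union> T"
  proof
    fix y assume "y \<in> {x..<2 * x}"
    then have y: "x \<le> y" "y < 2 * x" by auto
    consider "y \<in> lower" | "y - x \<in> diff_set" | "2 * x - y \<in> half_set" | "2 * y - x \<in> half_set" | "y \<in> T"
      using below_cover[OF assms(1,2) y] unfolding T_def by blast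
    then show "y \<in> (P \<union> Q) \<union> R \<union> S \<union> T"
    proof cases
      case 1
      with y show ?thesis by (simp add: P_def)
    next
      case 2
      with y have "y \<in> Q" unfolding Q_def by (intro image_eqI[of _ _ "y - x"]) auto
      then show ?thesis by blast
    next
      case 3
      with y have "y \<in> R" unfolding R_def by (intro image_eqI[of _ _ "2 * x - y"]) auto
      then show ?thesis by blast
    next
      case 4
      with y have "y \<in> S" unfolding S_def by (intro image_eqI[of _ _ "2 * y - x"]) auto
      then show ?thesis by blast
    qed blast
  qed
  then have "card {x..<2 * x} \<le> card ((P \<union> Q) \<union> R \<union> S \<union> T)"
    using \<open>finite P\<close> \<open>finite Q\<close> \<open>finite R\<close> \<open>finite S\<close> \<open>finite T\<close> by (intro card_mono) auto
  also have "\<dots> \<le> card (P \<union> Q) + card R + card S + card T"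
    by (meson add_le_mono card_Un_le order_refl order_trans)
  finally have "x + card (P \<inter> Q) \<le> card P + card Q + card R + card S + card T"
    using card_Un_Int[OF \<open>finite P\<close> \<open>finite Q\<close>] by simp
  moreover have "card {y \<in> lower. x \<le> y \<and> y < 2 * x \<and> y - x \<in> diff_set} \<le> card (P \<inter> Q)"
    using \<open>finite P\<close> by (intro card_mono) (auto simp: P_def Q_def intro!: image_eqI[of _ _ "_ - x"])
  ultimately show ?thesis
    using card unfolding P_def by linarith
qed

section \<open>Asymptotic form of the column count\<close>

text \<open>On \<open>upper\<close>, \<open>\<pi> x - x\<close> differs from
  \<open>(1 - \<beta>) * \<pi> x\<close> by exactly the slope error, so the density of
  \<open>lower\<close> is divided by \<open>1 - \<beta>\<close>. For \<open>half_set\<close> the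
  factor is \<open>2 - \<beta>\<close>.\<close>

lemma diff_set_dens:
  assumes "upper_slope \<beta>" "0 \<le> \<beta>" "\<beta> < 1"
  shows "has_dens diff_set (\<beta> / (1 + \<beta>) / (1 - \<beta>))"
  unfolding diff_set_def
proof (rule has_dens_image[OF inj_on_diff _ _ _ lower_dens[OF assms]])
  fix \<epsilon> :: real assume "\<epsilon> > 0"
  have "\<bar>real (\<pi> x - x) - (1 - \<beta>) * real (\<pi> x)\<bar> = \<bar>real x - \<beta> * real (\<pi> x)\<bar>" if "x \<in> upper" for x
    using that by (auto simp: upper_def of_nat_diff left_diff_distrib)
  with assms(1) \<open>\<epsilon> > 0\<close>
  show "\<exists>C. \<forall>x\<in>upper. \<bar>real (\<pi> x - x) - (1 - \<beta>) * real (\<pi> x)\<bar> \<le> \<epsilon> * real (\<pi> x) + C"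
    unfolding upper_slope_def by simp
qed (use assms in auto)

lemma half_set_dens:
  assumes "upper_slope \<beta>" "0 \<le> \<beta>" "\<beta> < 1"
  shows "has_dens half_set (\<beta> / (1 + \<beta>) / (2 - \<beta>))"
  unfolding half_set_def
proof (rule has_dens_image[OF inj_on_half _ _ _ lower_dens[OF assms]])
  fix \<epsilon> :: real assume "\<epsilon> > 0"
  have "\<bar>real (2 * \<pi> x - x) - (2 - \<beta>) * real (\<pi> x)\<bar> = \<bar>real x - \<beta> * real (\<pi> x)\<bar>" if "x \<in> upper" for x
    using that by (auto simp: upper_def of_nat_diff left_diff_distrib)
  with assms(1) \<open>\<epsilon> > 0\<close>
  show "\<exists>C. \<forall>x\<in>upper. \<bar>real (2 * \<pi> x - x) - (2 - \<beta>) * real (\<pi> x)\<bar> \<le> \<epsilon> * real (\<pi> x) + C"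
    unfolding upper_slope_def by simp
qed (use assms in auto)

text \<open>Halving maps a parity class injectively to the integers at half the scale.\<close>

lemma card_parity_window:
  assumes "1 \<le> X" "X \<le> Y"
  shows "real (card (window {s. even s = p} X Y)) \<le> (Y - X) / 2 + 3"
proof -
  \<comment> \<open>The \<open>- 1\<close> allows for odd \<open>s\<close>, where
    \<open>s div 2\<close> is \<open>(s - 1) / 2\<close>.\<close>
  let ?u = "(X - 1) / 2" and ?v = "Y / 2"
  have "inj_on (\<lambda>s. s div 2) (window {s. even s = p} X Y)"
    by (rule inj_onI) (auto, presburger?)
  then have "card (window {s. even s = p} X Y) = card ((\<lambda>s. s div 2) ` window {s. even s = p} X Y)"
    by (simp add: card_image)
  also have "\<dots> \<le> card (window UNIV ?u ?v)"
  proof (intro card_mono finite_window subsetI)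
    fix t assume "t \<in> (\<lambda>s. s div 2) ` window {s. even s = p} X Y"
    then obtain s where "t = s div 2" "X \<le> real s" "real s \<le> Y" by auto
    moreover have "2 * (s div 2) \<le> s" "s \<le> 2 * (s div 2) + 1" by presburger+
    ultimately have "real (2 * t) \<le> real s" "real s \<le> real (2 * t + 1)" by (metis of_nat_mono)+
    with \<open>X \<le> real s\<close> \<open>real s \<le> Y\<close> show "t \<in> window UNIV ?u ?v" by simp
  qed
  finally have "real (card (window {s. even s = p} X Y)) \<le> count_le UNIV ?v - count_le UNIV ?u + 1"
    using card_window[of ?u ?v UNIV] assms by simp
  moreover have "count_le UNIV ?v = real_of_int \<lfloor>?v\<rfloor> + 1" "count_le UNIV ?u = real_of_int \<lfloor>?u\<rfloor> + 1"
    by (rule count_le_UNIV, use assms in simp)+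
  moreover have "real_of_int \<lfloor>?v\<rfloor> \<le> ?v" "?u < real_of_int \<lfloor>?u\<rfloor> + 1"
    by (rule of_int_floor_le, rule floor_correct[THEN conjunct2, simplified])
  ultimately show ?thesis by (simp add: field_simps)
qed

text \<open>A slope below 1/2 gives \<open>upper\<close> density at least 2/3, more than the 1/2
  that a single parity class can supply.\<close>

lemma upper_parity:
  assumes "upper_slope \<beta>" "0 \<le> \<beta>" "\<beta> < 1 / 2" "0 < \<epsilon>" "\<epsilon> \<le> 1"
  obtains X0 where "\<And>X p. X \<ge> X0 \<Longrightarrow>
    \<exists>x\<in>upper. X \<le> real x \<and> real x \<le> X + \<epsilon> * X \<and> even x = p"
proof -
  have "1 / (1 + \<beta>) \<ge> 2 / 3" using assms by (simp add: field_simps)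
  have "has_dens upper (1 / (1 + \<beta>))" using assms by (intro upper_dens) auto
  \<comment> \<open>The density error over the window is at most \<open>\<epsilon> * X / 12\<close>,
    half of the surplus \<open>(2 / 3 - 1 / 2) * (\<epsilon> * X)\<close>; the other half exceeds
    the constants by the choice of \<open>X0\<close>.\<close>
  from has_dens_window[OF this, of "\<epsilon> / 24"] obtain C where C: "\<And>u v. 0 \<le> u \<Longrightarrow> u \<le> v \<Longrightarrow>
      \<bar>real (card (window upper u v)) - 1 / (1 + \<beta>) * (v - u)\<bar> \<le> \<epsilon> / 24 * v + C"
    using \<open>0 < \<epsilon>\<close> by auto
  define X0 where "X0 = max 1 (12 * (C + 4) / \<epsilon>)"
  have "\<exists>x\<in>upper. X \<le> real x \<and> real x \<le> X + \<epsilon> * X \<and> even x = p" if "X \<ge> X0" for X p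
  proof (rule ccontr)
    assume neg: "\<not> (\<exists>x\<in>upper. X \<le> real x \<and> real x \<le> X + \<epsilon> * X \<and> even x = p)"
    have X: "1 \<le> X" "12 * (C + 4) \<le> \<epsilon> * X"
      using that \<open>\<epsilon> > 0\<close> by (auto simp: X0_def pos_divide_le_eq mult.commute)
    have eX: "0 \<le> \<epsilon> * X" "\<epsilon> * X \<le> X" using X assms by (auto intro: mult_left_le_one_le)
    have "window upper X (X + \<epsilon> * X) \<subseteq> window {s. even s = (\<not> p)} X (X + \<epsilon> * X)"
      using neg by auto
    then have "card (window upper X (X + \<epsilon> * X)) \<le> card (window {s. even s = (\<not> p)} X (X + \<epsilon> * X))"
      by (intro card_mono finite_window)
    then have "real (card (window upper X (X + \<epsilon> * X))) \<le> \<epsilon> * X / 2 + 3"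
      using card_parity_window[of X "X + \<epsilon> * X" "\<not> p"] X eX by simp
    moreover have "\<epsilon> / 24 * (X + \<epsilon> * X) \<le> \<epsilon> / 24 * (2 * X)"
      using eX \<open>\<epsilon> > 0\<close> by (intro mult_left_mono) auto
    moreover have "2 / 3 * (\<epsilon> * X) \<le> 1 / (1 + \<beta>) * (\<epsilon> * X)"
      using \<open>1 / (1 + \<beta>) \<ge> 2 / 3\<close> eX by (intro mult_right_mono) auto
    moreover have "\<epsilon> / 24 * (2 * X) = \<epsilon> * X / 12" by simp
    moreover have "\<bar>real (card (window upper X (X + \<epsilon> * X))) - 1 / (1 + \<beta>) * (\<epsilon> * X)\<bar>
        \<le> \<epsilon> / 24 * (X + \<epsilon> * X) + C"
      using C[of X "X + \<epsilon> * X"] X eX by simp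
    ultimately show False
      using X by argo
  qed
  then show ?thesis by (rule that)
qed

text \<open>
  Lines of slope 1/2 meet a column \<open>x\<close> only for offsets congruent to \<open>x\<close> modulo 2.  Adding up the
  covers of two columns of opposite parity therefore charges each element of \<open>half_set\<close> once.
\<close>
lemma cover_inequality:
  assumes slope: "upper_slope \<beta>" "0 \<le> \<beta>" "\<beta> < 1 / 2" and \<epsilon>: "0 < \<epsilon>" "\<epsilon> \<le> 1"
    and overlap: "\<And>X. X \<ge> X0 \<Longrightarrow> \<exists>x\<in>upper. X \<le> real x \<and> real x \<le> X + \<epsilon> * X \<and>
      q * X \<le> real (card {y \<in> lower. x \<le> y \<and> y < 2 * x \<and> y - x \<in> diff_set})"
  defines "b \<equiv> \<beta> / (1 + \<beta>)"
  shows "2 + q \<le> 2 * b * (1 + 2 * \<epsilon>) + 2 * (b / (1 - \<beta>)) * (1 + \<epsilon>)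
    + b / (2 - \<beta>) * (4 + 5 * \<epsilon>) + 22 * \<epsilon>\<^sup>2"
proof -
  define d where "d = b / (1 - \<beta>)"
  define l where "l = b / (2 - \<beta>)"
  have "\<beta> < 1" using slope by simp
  obtain C1 where C1: "\<And>u v. 0 \<le> u \<Longrightarrow> u \<le> v \<Longrightarrow>
      \<bar>real (card (window lower u v)) - b * (v - u)\<bar> \<le> \<epsilon>\<^sup>2 * v + C1"
    using has_dens_window[OF lower_dens[OF slope(1,2) \<open>\<beta> < 1\<close>], of "\<epsilon>\<^sup>2"] \<epsilon> unfolding b_def by auto
  obtain C2 where C2: "\<And>u v. 0 \<le> u \<Longrightarrow> u \<le> v \<Longrightarrow>
      \<bar>real (card (window diff_set u v)) - d * (v - u)\<bar> \<le> \<epsilon>\<^sup>2 * v + C2"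
    using has_dens_window[OF diff_set_dens[OF slope(1,2) \<open>\<beta> < 1\<close>], of "\<epsilon>\<^sup>2"] \<epsilon> unfolding b_def d_def by auto
  obtain C3 where C3: "\<And>u v. 0 \<le> u \<Longrightarrow> u \<le> v \<Longrightarrow>
      \<bar>real (card (window half_set u v)) - l * (v - u)\<bar> \<le> \<epsilon>\<^sup>2 * v + C3"
    using has_dens_window[OF half_set_dens[OF slope(1,2) \<open>\<beta> < 1\<close>], of "\<epsilon>\<^sup>2"] \<epsilon> unfolding b_def l_def by auto
  define E where "E = {j \<in> upper. \<pi> j < 2 * j}"
  have finE: "finite E" unfolding E_def using finite_shallow slope by blast
  obtain X1 where X1: "\<And>X p. X \<ge> X1 \<Longrightarrow>
      \<exists>x\<in>upper. X \<le> real x \<and> real x \<le> X + \<epsilon> * X \<and> even x = p"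
    using upper_parity[OF slope \<epsilon>] by blast
  \<comment> \<open>Columns beyond \<open>Max (insert 0 E)\<close> satisfy
    \<open>2 * t \<le> \<pi> t\<close>, as \<open>cover_count\<close> demands; inserting 0 gives
    \<open>Max\<close> a nonempty set.\<close>
  define X2 where "X2 = max (max X0 X1) (max 1 (real (Max (insert 0 E)) + 1))"
  define K where "K = 2 * C1 + 2 * C2 + 3 * C3 + 2 * real (card E)"
  define B where "B = 2 * b * (1 + 2 * \<epsilon>) + 2 * d * (1 + \<epsilon>) + l * (4 + 5 * \<epsilon>) + 22 * \<epsilon>\<^sup>2"
  have lin: "(2 + q - B) * X \<le> K" if "X \<ge> X2" for X
  proof -
    have X: "X0 \<le> X" "X1 \<le> X" "1 \<le> X" "real (Max (insert 0 E)) < X"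
      using that by (auto simp: X2_def)
    define Y where "Y = X + \<epsilon> * X"
    have "0 \<le> \<epsilon> * X" "\<epsilon> * X \<le> X" using X \<epsilon> by (auto intro: mult_left_le_one_le)
    then have Y: "X \<le> Y" "Y \<le> 2 * X" by (auto simp: Y_def)
    obtain x where x: "x \<in> upper" "X \<le> real x" "real x \<le> Y"
        and ov: "q * X \<le> real (card {y \<in> lower. x \<le> y \<and> y < 2 * x \<and> y - x \<in> diff_set})"
      using overlap[OF X(1)] unfolding Y_def by blast
    \<comment> \<open>A companion column of the other parity; the gain \<open>q * X\<close> is taken
      from \<open>x\<close> alone.\<close>
    obtain x' where x': "x' \<in> upper" "X \<le> real x'" "real x' \<le> Y" and par: "even x' = (\<not> even x)"
      using X1[OF X(2), of "odd x"] unfolding Y_def by blast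
    define N where "N t = card {s \<in> half_set. t \<le> s \<and> s < 3 * t \<and> even (s + t)}" for t
    have cov: "real t + real (card {y \<in> lower. t \<le> y \<and> y < 2 * t \<and> y - t \<in> diff_set}) \<le>
        real (card (window lower X (2 * Y))) + real (card (window diff_set 0 Y))
        + real (card (window half_set 0 Y)) + real (N t) + real (card E)"
      if t: "t \<in> upper" "X \<le> real t" "real t \<le> Y" for t
    proof -
      have "t \<notin> E"
      proof
        assume "t \<in> E"
        with finE have "t \<le> Max (insert 0 E)" by simp
        with t X show False by linarith
      qed
      then have "2 * t \<le> \<pi> t" using t by (auto simp: E_def)
      note cover_count[OF t(1) this finE[unfolded E_def], folded E_def]
      moreover have "card {s \<in> lower. t \<le> s \<and> s < 2 * t} \<le> card (window lower X (2 * Y))"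
        using t by (intro card_mono finite_window) auto
      moreover have "card {s \<in> diff_set. s < t} \<le> card (window diff_set 0 Y)"
        using t by (intro card_mono finite_window) auto
      moreover have "card {s \<in> half_set. s \<le> t} \<le> card (window half_set 0 Y)"
        using t by (intro card_mono finite_window) auto
      ultimately show ?thesis unfolding N_def by linarith
    qed
    have "N x + N x' \<le> card (window half_set X (3 * Y))"
    proof -
      let ?H = "\<lambda>t. {s \<in> half_set. t \<le> s \<and> s < 3 * t \<and> even (s + t)}"
      have fin: "finite (?H t)" for t by (rule finite_subset[of _ "{..<3 * t}"]) auto
      have "?H x \<inter> ?H x' = {}" using par by auto
      then have "N x + N x' = card (?H x \<union> ?H x')"
        unfolding N_def using fin by (intro card_Un_disjoint[symmetric]) auto
      also have "\<dots> \<le> card (window half_set X (3 * Y))"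
        using x x' by (intro card_mono finite_window) auto
      finally show ?thesis .
    qed
    then have "2 * X + q * X \<le> 2 * real (card (window lower X (2 * Y))) + 2 * real (card (window diff_set 0 Y))
        + 2 * real (card (window half_set 0 Y)) + real (card (window half_set X (3 * Y))) + 2 * real (card E)"
      using cov[OF x] cov[OF x'] ov x(2) x'(2) by linarith
    also have "\<dots> \<le> 2 * (b * (2 * Y - X) + \<epsilon>\<^sup>2 * (2 * Y) + C1) + 2 * (d * Y + \<epsilon>\<^sup>2 * Y + C2)
        + 2 * (l * Y + \<epsilon>\<^sup>2 * Y + C3) + (l * (3 * Y - X) + \<epsilon>\<^sup>2 * (3 * Y) + C3) + 2 * real (card E)"
    proof -
      have "real (card (window lower X (2 * Y))) \<le> b * (2 * Y - X) + \<epsilon>\<^sup>2 * (2 * Y) + C1"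
        using C1[of X "2 * Y"] Y X by linarith
      moreover have "real (card (window diff_set 0 Y)) \<le> d * Y + \<epsilon>\<^sup>2 * Y + C2"
        using C2[of 0 Y] Y X by simp
      moreover have "real (card (window half_set 0 Y)) \<le> l * Y + \<epsilon>\<^sup>2 * Y + C3"
        using C3[of 0 Y] Y X by simp
      moreover have "real (card (window half_set X (3 * Y))) \<le> l * (3 * Y - X) + \<epsilon>\<^sup>2 * (3 * Y) + C3"
        using C3[of X "3 * Y"] Y X by linarith
      ultimately show ?thesis by argo
    qed
    \<comment> \<open>The errors \<open>\<epsilon>\<^sup>2 * Y\<close> occur with weights 4, 2, 2
      and 3, in total 11; \<open>Y \<le> 2 * X\<close> turns this into 22.\<close>
    also have "\<dots> = (B - 22 * \<epsilon>\<^sup>2) * X + 11 * (\<epsilon>\<^sup>2 * Y) + K"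
      by (simp add: B_def K_def Y_def algebra_simps)
    also have "\<epsilon>\<^sup>2 * Y \<le> \<epsilon>\<^sup>2 * (2 * X)"
      using Y by (intro mult_left_mono) auto
    finally show ?thesis by (simp add: algebra_simps)
  qed
  have "2 + q \<le> B"
  proof (rule ccontr)
    assume "\<not> 2 + q \<le> B"
    then obtain n :: nat where "K < real n * (2 + q - B)"
      using reals_Archimedean3[of "2 + q - B"] by auto
    moreover have "real n * (2 + q - B) \<le> max X2 (real n) * (2 + q - B)"
      using \<open>\<not> 2 + q \<le> B\<close> by (intro mult_right_mono) auto
    ultimately show False
      using lin[of "max X2 (real n)"] by (simp add: mult.commute)
  qed
  then show ?thesis by (simp add: B_def d_def l_def)
qed

text \<open>
  For \<open>y \<in> lower\<close> the points \<open>y - s\<close>, \<open>s \<in> diff_set\<close>, are denser than \<open>lower\<close>, so many of them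
  fall into \<open>upper\<close>; averaging over the columns \<open>x \<in> upper\<close> gives one with a large overlap.
\<close>
lemma overlap_exists:
  assumes slope: "upper_slope \<beta>" "0 \<le> \<beta>" "\<beta> < 1" and \<epsilon>: "0 < \<epsilon>" "\<epsilon> \<le> 1 / 2"
  defines "a \<equiv> 1 / (1 + \<beta>)" and "b \<equiv> \<beta> / (1 + \<beta>)"
  defines "d \<equiv> b / (1 - \<beta>)"
  assumes pos: "b * (1 - 2 * \<epsilon>) - 3 * \<epsilon>\<^sup>2 > 0" "d - b - 5 * \<epsilon> > 0"
  shows "\<exists>X0. \<forall>X\<ge>X0. \<exists>x\<in>upper. X \<le> real x \<and> real x \<le> X + \<epsilon> * X \<and>
    (b * (1 - 2 * \<epsilon>) - 3 * \<epsilon>\<^sup>2) * (d - b - 5 * \<epsilon>) / (a + 3 * \<epsilon>) * X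
      \<le> real (card {y \<in> lower. x \<le> y \<and> y < 2 * x \<and> y - x \<in> diff_set})"
proof -
  obtain C0 where C0: "\<And>u v. 0 \<le> u \<Longrightarrow> u \<le> v \<Longrightarrow>
      \<bar>real (card (window upper u v)) - a * (v - u)\<bar> \<le> \<epsilon>\<^sup>2 * v + C0"
    using has_dens_window[OF upper_dens[OF slope], of "\<epsilon>\<^sup>2"] \<epsilon> unfolding a_def by auto
  obtain C1 where C1: "\<And>u v. 0 \<le> u \<Longrightarrow> u \<le> v \<Longrightarrow>
      \<bar>real (card (window lower u v)) - b * (v - u)\<bar> \<le> \<epsilon>\<^sup>2 * v + C1"
    using has_dens_window[OF lower_dens[OF slope], of "\<epsilon>\<^sup>2"] \<epsilon> unfolding b_def by auto
  obtain C2 where C2: "\<And>u v. 0 \<le> u \<Longrightarrow> u \<le> v \<Longrightarrow>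
      \<bar>real (card (window diff_set u v)) - d * (v - u)\<bar> \<le> \<epsilon>\<^sup>2 * v + C2"
    using has_dens_window[OF diff_set_dens[OF slope], of "\<epsilon>\<^sup>2"] \<epsilon> unfolding d_def b_def by auto
  define C where "C = \<bar>C0\<bar> + \<bar>C1\<bar> + \<bar>C2\<bar> + 1"
  have C: "0 < C" "C0 < C" "C1 < C" "C1 + C2 < C" by (auto simp: C_def)
  \<comment> \<open>\<open>s * X\<close> will bound the number of rows from below and
    \<open>m * X\<close> the number of suitable columns per row. As there are fewer than
    \<open>(a * \<epsilon> + 3 * \<epsilon>\<^sup>2) * X\<close> columns, \<open>q * X\<close> is
    the resulting average per column.\<close>
  define s where "s = b * (1 - 2 * \<epsilon>) - 3 * \<epsilon>\<^sup>2"
  define m where "m = (d - b) * \<epsilon> - 5 * \<epsilon>\<^sup>2"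
  define q where "q = s * (d - b - 5 * \<epsilon>) / (a + 3 * \<epsilon>)"
  have "a > 0" using slope by (simp add: a_def)
  have m_eq: "m = (d - b - 5 * \<epsilon>) * \<epsilon>" by (simp add: m_def power2_eq_square algebra_simps)
  have "s > 0" "m > 0" using pos \<epsilon> by (auto simp: s_def m_eq)
  then have "q > 0" using pos \<open>a > 0\<close> \<epsilon> by (simp add: q_def)
  have q_eq: "(a * \<epsilon> + 3 * \<epsilon>\<^sup>2) * q = s * m"
  proof -
    have "a * \<epsilon> + 3 * \<epsilon>\<^sup>2 = (a + 3 * \<epsilon>) * \<epsilon>" by (simp add: power2_eq_square algebra_simps)
    then show ?thesis using \<open>a > 0\<close> \<epsilon> by (simp add: q_def m_eq)
  qed
  have "\<exists>x\<in>upper. X \<le> real x \<and> real x \<le> X + \<epsilon> * X \<and>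
      q * X \<le> real (card {y \<in> lower. x \<le> y \<and> y < 2 * x \<and> y - x \<in> diff_set})"
    if "X \<ge> max 1 (2 * C / \<epsilon>\<^sup>2)" for X
  proof (rule ccontr)
    have X: "1 \<le> X" "2 * C \<le> \<epsilon>\<^sup>2 * X"
      using that \<epsilon> by (auto simp: pos_divide_le_eq mult.commute)
    define Y where "Y = X + \<epsilon> * X"
    have "0 \<le> \<epsilon> * X" "\<epsilon> * X \<le> 1 / 2 * X" using X \<epsilon> by (auto intro: mult_right_mono)
    then have Y: "X \<le> Y" "Y \<le> 2 * X - \<epsilon> * X" "Y - X = \<epsilon> * X"
      unfolding Y_def by linarith+
    define A where "A = window upper X Y"
    \<comment> \<open>Rows in this range satisfy \<open>x \<le> y < 2 * x\<close> for all columns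
      \<open>x\<close> in \<open>A\<close> simultaneously.\<close>
    define V where "V = window lower Y (2 * X - \<epsilon> * X)"
    assume "\<not> (\<exists>x\<in>upper. X \<le> real x \<and> real x \<le> X + \<epsilon> * X \<and>
      q * X \<le> real (card {y \<in> lower. x \<le> y \<and> y < 2 * x \<and> y - x \<in> diff_set}))"
    then have few: "real (card {y \<in> lower. x \<le> y \<and> y < 2 * x \<and> y - x \<in> diff_set}) < q * X" if "x \<in> A" for x
      using that by (auto simp: A_def Y_def not_le)
    have err: "\<epsilon>\<^sup>2 * v \<le> 2 * (\<epsilon>\<^sup>2 * X)" if "v \<le> 2 * X" for v
    proof -
      have "\<epsilon>\<^sup>2 * v \<le> \<epsilon>\<^sup>2 * (2 * X)" using that by (intro mult_left_mono) auto
      then show ?thesis by simp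
    qed
    have cardA: "real (card A) < (a * \<epsilon> + 3 * \<epsilon>\<^sup>2) * X"
    proof -
      have "real (card A) \<le> a * (\<epsilon> * X) + \<epsilon>\<^sup>2 * Y + C0"
        using C0[of X Y] X Y unfolding A_def by simp
      moreover have "C0 < \<epsilon>\<^sup>2 * X" using X(2) C by linarith
      ultimately show ?thesis
        using err[of Y] Y \<open>0 \<le> \<epsilon> * X\<close> by (simp add: distrib_right)
    qed
    have cardV: "s * X \<le> real (card V)"
    proof -
      have "b * (2 * X - \<epsilon> * X - Y) - \<epsilon>\<^sup>2 * (2 * X - \<epsilon> * X) - C1 \<le> real (card V)"
        using C1[of Y "2 * X - \<epsilon> * X"] X Y unfolding V_def by simp
      moreover have "C1 \<le> \<epsilon>\<^sup>2 * X" using X(2) C by linarith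
      moreover have "b * (2 * X - \<epsilon> * X - Y) = b * (1 - 2 * \<epsilon>) * X"
        by (simp add: Y_def algebra_simps)
      ultimately show ?thesis
        using err[of "2 * X - \<epsilon> * X"] \<open>0 \<le> \<epsilon> * X\<close> unfolding s_def left_diff_distrib[of _ _ X] by linarith
    qed
    \<comment> \<open>About \<open>d * \<epsilon> * X\<close> points \<open>y - s\<close> with
      \<open>s\<close> in \<open>diff_set\<close> fall between \<open>X\<close> and
      \<open>Y\<close>. At most about \<open>b * \<epsilon> * X\<close> of them are in
      \<open>lower\<close>; the others are in \<open>A\<close>.\<close>
    have fibre: "m * X \<le> real (card {x \<in> A. y - x \<in> diff_set})" if "y \<in> V" for y
    proof -
      have y: "Y \<le> real y" "real y \<le> 2 * X" using that \<open>0 \<le> \<epsilon> * X\<close> by (auto simp: V_def)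
      let ?D = "window diff_set (real y - Y) (real y - X)"
      have "(\<lambda>s. y - s) ` ?D \<subseteq> {x \<in> A. y - x \<in> diff_set} \<union> window lower X Y"
      proof (rule image_subsetI)
        fix s assume s: "s \<in> ?D"
        then have "s \<le> y" using X by auto
        then have "real (y - s) = real y - real s" "y - (y - s) = s" by auto
        moreover have "y - s \<in> upper \<or> y - s \<in> lower" using upper_Un_lower by blast
        ultimately show "y - s \<in> {x \<in> A. y - x \<in> diff_set} \<union> window lower X Y"
          using s by (auto simp: A_def)
      qed
      then have "card ((\<lambda>s. y - s) ` ?D) \<le> card ({x \<in> A. y - x \<in> diff_set} \<union> window lower X Y)"
        by (intro card_mono finite_UnI finite_window finite_subset[OF _ finite_window[of upper X Y]])
          (auto simp: A_def)
      also have "\<dots> \<le> card {x \<in> A. y - x \<in> diff_set} + card (window lower X Y)"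
        by (rule card_Un_le)
      also have "card ((\<lambda>s. y - s) ` ?D) = card ?D"
      proof (intro card_image inj_onI)
        fix s t assume "s \<in> ?D" "t \<in> ?D" "y - s = y - t"
        moreover from this have "s \<le> y" "t \<le> y" using X by auto
        ultimately show "s = t" by linarith
      qed
      finally have "real (card ?D) \<le> real (card {x \<in> A. y - x \<in> diff_set}) + real (card (window lower X Y))"
        by linarith
      moreover have "d * (\<epsilon> * X) - \<epsilon>\<^sup>2 * (real y - X) - C2 \<le> real (card ?D)"
        using C2[of "real y - Y" "real y - X"] y Y by simp
      moreover have "real (card (window lower X Y)) \<le> b * (\<epsilon> * X) + \<epsilon>\<^sup>2 * Y + C1"
        using C1[of X Y] X Y by simp
      moreover have "C1 + C2 \<le> \<epsilon>\<^sup>2 * X" using X(2) C by linarith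
      moreover have "m * X = d * (\<epsilon> * X) - b * (\<epsilon> * X) - 5 * (\<epsilon>\<^sup>2 * X)"
        by (simp add: m_def algebra_simps)
      ultimately show ?thesis
        using err[of "real y - X"] err[of Y] y Y X \<open>0 \<le> \<epsilon> * X\<close> by linarith
    qed
    have "s * X * (m * X) \<le> real (card V) * (m * X)"
      using cardV \<open>m > 0\<close> X by (intro mult_right_mono) auto
    also have "\<dots> = (\<Sum>y\<in>V. m * X)" by simp
    also have "\<dots> \<le> (\<Sum>y\<in>V. real (card {x \<in> A. y - x \<in> diff_set}))"
      by (intro sum_mono fibre)
    \<comment> \<open>Double counting of the pairs of a column in \<open>A\<close> and a row in
      \<open>V\<close> that share a diagonal with offset in \<open>diff_set\<close>.\<close>
    also have "\<dots> = real (\<Sum>x\<in>A. card {y \<in> V. y - x \<in> diff_set})"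
      unfolding of_nat_sum[symmetric]
      by (subst sum_multicount_gen[where k = "\<lambda>y. card {x \<in> A. y - x \<in> diff_set}"])
        (auto simp: A_def V_def)
    also have "\<dots> \<le> (\<Sum>x\<in>A. q * X)"
      unfolding of_nat_sum
    proof (rule sum_mono)
      fix x assume x: "x \<in> A"
      have "{y \<in> V. y - x \<in> diff_set} \<subseteq> {y \<in> lower. x \<le> y \<and> y < 2 * x \<and> y - x \<in> diff_set}"
      proof safe
        fix y assume "y \<in> V"
        with x Y have y: "real x \<le> real y" "real y \<le> 2 * X - \<epsilon> * X" "X \<le> real x" "y \<in> lower"
          by (auto simp: A_def V_def)
        moreover have "0 < \<epsilon> * X" using X \<epsilon> by simp
        ultimately have "real y < 2 * real x" by linarith
        with y show "x \<le> y" "y < 2 * x" "y \<in> lower" by linarith+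
      qed
      moreover have "finite {y \<in> lower. x \<le> y \<and> y < 2 * x \<and> y - x \<in> diff_set}"
        by (rule finite_subset[of _ "{..<2 * x}"]) auto
      ultimately show "real (card {y \<in> V. y - x \<in> diff_set}) \<le> q * X"
        using few[OF x] by (meson card_mono le_less_trans less_imp_le of_nat_mono)
    qed
    also have "\<dots> = real (card A) * (q * X)" by simp
    also have "\<dots> < (a * \<epsilon> + 3 * \<epsilon>\<^sup>2) * X * (q * X)"
      using cardA \<open>q > 0\<close> X by (intro mult_strict_right_mono) auto
    also have "\<dots> = s * m * X * X"
      unfolding q_eq[symmetric] by simp
    finally show False by (simp add: mult_ac)
  qed
  then show ?thesis unfolding q_def s_def by blast
qed

section \<open>The final inequality in the slope\<close>

text \<open>Clearing denominators leaves a quartic that would have to be nonpositive, but it is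
  still slightly positive at 0.36603, approximately the positive root of
  \<open>2 * \<beta>\<^sup>2 + 2 * \<beta> = 1\<close>. The small margin calls for sharp rational
  constants.\<close>

lemma slope_contradiction:
  fixes \<beta> :: real
  assumes "0 \<le> \<beta>" "2 * \<beta>\<^sup>2 + 2 * \<beta> \<le> 1"
    and "2 + \<beta> / (1 + \<beta>) * (\<beta> / (1 + \<beta>) / (1 - \<beta>) - \<beta> / (1 + \<beta>)) / (1 / (1 + \<beta>))
      \<le> 2 * (\<beta> / (1 + \<beta>)) + 2 * (\<beta> / (1 + \<beta>) / (1 - \<beta>)) + \<beta> / (1 + \<beta>) / (2 - \<beta>) * 4"
  shows False
proof -
  \<comment> \<open>The constant lies just above the root \<open>(sqrt 3 - 1) / 2\<close>.\<close>
  have half: "\<beta> < 3661 / 10000"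
  proof (rule ccontr)
    assume "\<not> \<beta> < 3661 / 10000"
    then have "3661 / 10000 * (3661 / 10000) \<le> \<beta> * \<beta>" by (intro mult_mono) auto
    with assms(2) \<open>\<not> \<beta> < 3661 / 10000\<close> show False by (simp add: power2_eq_square)
  qed
  have pos: "1 + \<beta> > 0" "1 - \<beta> > 0" "2 - \<beta> > 0" using assms half by auto
  define D where "D = (1 + \<beta>) * (1 - \<beta>) * (2 - \<beta>)"
  have "D > 0" using pos by (simp add: D_def)
  have l: "(2 + \<beta> / (1 + \<beta>) * (\<beta> / (1 + \<beta>) / (1 - \<beta>) - \<beta> / (1 + \<beta>)) / (1 / (1 + \<beta>))) * D
      = (2 * (1 + \<beta>) * (1 - \<beta>) + \<beta> ^ 3) * (2 - \<beta>)"
  proof -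
    have "\<beta> / (1 + \<beta>) * (\<beta> / (1 + \<beta>) / (1 - \<beta>) - \<beta> / (1 + \<beta>)) / (1 / (1 + \<beta>))
        = \<beta> ^ 3 / ((1 + \<beta>) * (1 - \<beta>))"
      using pos by (simp add: divide_simps) (simp add: power3_eq_cube algebra_simps)
    moreover have "\<beta> ^ 3 / ((1 + \<beta>) * (1 - \<beta>)) * D = \<beta> ^ 3 * (2 - \<beta>)"
      using pos by (simp add: D_def)
    ultimately show ?thesis unfolding distrib_right by (simp add: D_def)
  qed
  have r: "(2 * (\<beta> / (1 + \<beta>)) + 2 * (\<beta> / (1 + \<beta>) / (1 - \<beta>)) + \<beta> / (1 + \<beta>) / (2 - \<beta>) * 4) * D
      = 2 * \<beta> * (1 - \<beta>) * (2 - \<beta>) + 2 * \<beta> * (2 - \<beta>) + 4 * \<beta> * (1 - \<beta>)"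
  proof -
    have "\<beta> / (1 + \<beta>) * D = \<beta> * (1 - \<beta>) * (2 - \<beta>)"
      "\<beta> / (1 + \<beta>) / (1 - \<beta>) * D = \<beta> * (2 - \<beta>)"
      "\<beta> / (1 + \<beta>) / (2 - \<beta>) * D = \<beta> * (1 - \<beta>)"
      using pos by (simp_all add: D_def)
    moreover have "(2 * p + 2 * q + r * 4) * D = 2 * (p * D) + 2 * (q * D) + 4 * (r * D)" for p q r
      by (simp add: algebra_simps)
    ultimately show ?thesis by (simp only: mult.assoc)
  qed
  have "(2 * (1 + \<beta>) * (1 - \<beta>) + \<beta> ^ 3) * (2 - \<beta>)
      \<le> 2 * \<beta> * (1 - \<beta>) * (2 - \<beta>) + 2 * \<beta> * (2 - \<beta>) + 4 * \<beta> * (1 - \<beta>)"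
    using mult_right_mono[OF assms(3), of D] \<open>D > 0\<close> unfolding l r by simp
  then have "4 - 14 * \<beta> + 8 * \<beta>\<^sup>2 + \<beta> ^ 3 * (2 - \<beta>) \<le> 0"
    by (simp add: power2_eq_square power3_eq_cube algebra_simps)
  moreover have "\<beta> ^ 3 * (2 - \<beta>) \<ge> 163 / 100 * \<beta> ^ 3"
    using mult_left_mono[of "163 / 100" "2 - \<beta>" "\<beta> ^ 3"] half assms(1) by (simp add: mult.commute)
  ultimately have "4 - 14 * \<beta> + 8 * \<beta>\<^sup>2 + 163 / 100 * \<beta> ^ 3 \<le> 0" by linarith
  \<comment> \<open>Tangents at 0.366, close to the critical endpoint, bound the square and the cube
    from below and leave a linear inequality.\<close>
  moreover have "\<beta>\<^sup>2 \<ge> 2 * (366 / 1000) * \<beta> - (366 / 1000)\<^sup>2"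
    using zero_le_power2[of "\<beta> - 366 / 1000"] by (simp add: power2_eq_square algebra_simps)
  moreover have "\<beta> ^ 3 \<ge> 3 * (366 / 1000)\<^sup>2 * \<beta> - 2 * (366 / 1000) ^ 3"
  proof -
    have "(\<beta> - r)\<^sup>2 * (\<beta> + 2 * r) = \<beta> ^ 3 - (3 * r\<^sup>2 * \<beta> - 2 * r ^ 3)" for r
      by (simp add: power2_eq_square power3_eq_cube algebra_simps)
    moreover have "0 \<le> (\<beta> - 366 / 1000)\<^sup>2 * (\<beta> + 2 * (366 / 1000))" using assms by simp
    ultimately show ?thesis by (metis diff_ge_0_iff_ge)
  qed
  ultimately show False using half by (simp add: power2_eq_square power3_eq_cube)
qed

text \<open>The gain from \<open>overlap_exists\<close> is inserted into
  \<open>cover_inequality\<close>, and \<open>\<epsilon>\<close> tends to 0 from the right.\<close>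

lemma not_upper_slope:
  assumes "0 \<le> \<beta>" "\<beta> \<le> 1"
  shows "\<not> upper_slope \<beta>"
proof
  assume slope: "upper_slope \<beta>"
  with upper_slope_neq_1 assms have "\<beta> < 1" by (cases "\<beta> = 1") auto
  note bound = slope_bound[OF slope assms(1) this]
  define a where "a = 1 / (1 + \<beta>)"
  define b where "b = \<beta> / (1 + \<beta>)"
  define d where "d = b / (1 - \<beta>)"
  define l where "l = b / (2 - \<beta>)"
  define rhs where "rhs \<epsilon> = 2 * b * (1 + 2 * \<epsilon>) + 2 * d * (1 + \<epsilon>) + l * (4 + 5 * \<epsilon>) + 22 * \<epsilon>\<^sup>2" for \<epsilon>
  define q where "q \<epsilon> = (b * (1 - 2 * \<epsilon>) - 3 * \<epsilon>\<^sup>2) * (d - b - 5 * \<epsilon>) / (a + 3 * \<epsilon>)" for \<epsilon>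
  have "a > 0" using assms by (simp add: a_def)
  have rhs_lim: "(rhs \<longlongrightarrow> 2 * b * (1 + 2 * 0) + 2 * d * (1 + 0) + l * (4 + 5 * 0) + 22 * 0\<^sup>2) (at_right 0)"
    unfolding rhs_def by (intro tendsto_intros)
  have small: "\<forall>\<^sub>F \<epsilon> in at_right 0. 0 < \<epsilon> \<and> \<epsilon> < (1 / 2 :: real)"
    using eventually_at_right_real[of 0 "1 / 2 :: real"] by simp
  have ineq: "2 + q \<le> rhs \<epsilon>"
    if "0 < \<epsilon>" "\<epsilon> \<le> 1" and "\<And>X. X \<ge> X0 \<Longrightarrow> \<exists>x\<in>upper. X \<le> real x \<and> real x \<le> X + \<epsilon> * X \<and>
      q * X \<le> real (card {y \<in> lower. x \<le> y \<and> y < 2 * x \<and> y - x \<in> diff_set})" for q \<epsilon> X0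
    unfolding rhs_def b_def d_def l_def
    by (rule cover_inequality[OF slope assms(1) bound(2) that])
  \<comment> \<open>For slope 0 the positivity conditions of \<open>overlap_exists\<close> fail.
    Gain 0 suffices there: the right-hand side is \<open>22 * \<epsilon>\<^sup>2\<close>, which is
    below 2 at \<open>\<epsilon> = 1 / 10\<close>.\<close>
  have "\<beta> \<noteq> 0"
  proof
    assume "\<beta> = 0"
    have "2 + 0 \<le> rhs \<epsilon>" if \<epsilon>: "0 < \<epsilon>" "\<epsilon> < 1 / 2" for \<epsilon>
    proof -
      have "\<epsilon> \<le> 1" using \<epsilon> by simp
      obtain X0 where window: "\<And>X p. X \<ge> X0 \<Longrightarrow>
          \<exists>x\<in>upper. X \<le> real x \<and> real x \<le> X + \<epsilon> * X \<and> even x = p"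
        using upper_parity[OF slope assms(1) bound(2) \<epsilon>(1) \<open>\<epsilon> \<le> 1\<close>] by blast
      show ?thesis
      proof (rule ineq[OF \<epsilon>(1) \<open>\<epsilon> \<le> 1\<close>])
        fix X assume "X0 \<le> X"
        then show "\<exists>x\<in>upper. X \<le> real x \<and> real x \<le> X + \<epsilon> * X \<and>
            0 * X \<le> real (card {y \<in> lower. x \<le> y \<and> y < 2 * x \<and> y - x \<in> diff_set})"
          using window[of X True] by auto
      qed
    qed
    from this[of "1 / 10"] show False
      by (simp add: rhs_def d_def l_def b_def \<open>\<beta> = 0\<close> power2_eq_square)
  qed
  with assms have "\<beta> > 0" by simp
  then have "b > 0" by (simp add: b_def)
  have "b < d"
    using \<open>\<beta> > 0\<close> \<open>\<beta> < 1\<close> \<open>b > 0\<close> unfolding d_def by (simp add: pos_less_divide_eq)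
  have "((\<lambda>\<epsilon>. b * (1 - 2 * \<epsilon>) - 3 * \<epsilon>\<^sup>2) \<longlongrightarrow> b * (1 - 2 * 0) - 3 * 0\<^sup>2) (at_right 0)"
    by (intro tendsto_intros)
  from order_tendstoD(1)[OF this, of 0] \<open>b > 0\<close>
  have pos1: "\<forall>\<^sub>F \<epsilon> in at_right 0. 0 < b * (1 - 2 * \<epsilon>) - 3 * \<epsilon>\<^sup>2" by simp
  have "((\<lambda>\<epsilon>. d - b - 5 * \<epsilon>) \<longlongrightarrow> d - b - 5 * 0) (at_right 0)"
    by (intro tendsto_intros)
  from order_tendstoD(1)[OF this, of 0] \<open>b < d\<close>
  have pos2: "\<forall>\<^sub>F \<epsilon> in at_right 0. 0 < d - b - 5 * \<epsilon>" by simp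
  have "\<forall>\<^sub>F \<epsilon> in at_right 0. 2 + q \<epsilon> \<le> rhs \<epsilon>"
    using small pos1 pos2
  proof eventually_elim
    case (elim \<epsilon>)
    then have \<epsilon>: "0 < \<epsilon>" "\<epsilon> \<le> 1 / 2" by auto
    obtain X0 where "\<And>X. X \<ge> X0 \<Longrightarrow> \<exists>x\<in>upper. X \<le> real x \<and> real x \<le> X + \<epsilon> * X \<and>
        q \<epsilon> * X \<le> real (card {y \<in> lower. x \<le> y \<and> y < 2 * x \<and> y - x \<in> diff_set})"
      using overlap_exists[OF slope assms(1) \<open>\<beta> < 1\<close> \<epsilon>] elim(2,3)
      unfolding q_def d_def b_def a_def by blast
    then show ?case using \<epsilon> by (intro ineq) auto
  qed
  moreover have "((\<lambda>\<epsilon>. 2 + q \<epsilon>) \<longlongrightarrow>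
      2 + (b * (1 - 2 * 0) - 3 * 0\<^sup>2) * (d - b - 5 * 0) / (a + 3 * 0)) (at_right 0)"
    unfolding q_def using \<open>a > 0\<close> by (intro tendsto_intros) auto
  ultimately have "2 + (b * (1 - 2 * 0) - 3 * 0\<^sup>2) * (d - b - 5 * 0) / (a + 3 * 0)
      \<le> 2 * b * (1 + 2 * 0) + 2 * d * (1 + 0) + l * (4 + 5 * 0) + 22 * 0\<^sup>2"
    by (intro tendsto_le[OF trivial_limit_at_right_real rhs_lim])
  then have "2 + b * (d - b) / a \<le> 2 * b + 2 * d + l * 4" by simp
  then show False
    unfolding d_def l_def b_def a_def by (rule slope_contradiction[OF assms(1) bound(1)])
qed

section \<open>From limits of the sequences to slopes\<close>

lemma upper_slopeI:
  assumes lim: "(\<lambda>n. real (a_seq n) / real (b_seq n)) \<longlonglongrightarrow> \<beta>"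
  shows "upper_slope \<beta>"
  unfolding upper_slope_def
proof (intro allI impI)
  fix \<epsilon> :: real assume "\<epsilon> > 0"
  then obtain N where N: "\<And>n. n \<ge> N \<Longrightarrow> \<bar>real (a_seq n) / real (b_seq n) - \<beta>\<bar> < \<epsilon>"
    using LIMSEQ_D[OF lim] by (metis real_norm_def)
  \<comment> \<open>The sum dominates the error of each of the first \<open>N\<close>
    points.\<close>
  define C where "C = (\<Sum>n<N. \<bar>real (a_seq n) - \<beta> * real (b_seq n)\<bar>)"
  have "C \<ge> 0" unfolding C_def by (intro sum_nonneg) auto
  have "\<bar>real x - \<beta> * real (\<pi> x)\<bar> \<le> \<epsilon> * real (\<pi> x) + C" if x: "x \<in> upper" for x
  proof -
    obtain n where n: "x = a_seq n"
      using enumerate_Ex[of upper x] x infinite_le_\<pi> unfolding a_seq_def upper_def by metis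
    then have \<pi>x: "\<pi> x = b_seq n" by (simp add: b_seq_def)
    show ?thesis
    proof (cases "n < N")
      case True
      then have "\<bar>real x - \<beta> * real (\<pi> x)\<bar> \<le> C"
        unfolding C_def n \<pi>x[unfolded n] by (intro member_le_sum) auto
      moreover have "0 \<le> \<epsilon> * real (\<pi> x)" using \<open>\<epsilon> > 0\<close> by simp
      ultimately show ?thesis by linarith
    next
      case False
      show ?thesis
      proof (cases "\<pi> x = 0")
        case True
        with x \<open>C \<ge> 0\<close> show ?thesis by (simp add: upper_def)
      next
        case pos: False
        have "real x - \<beta> * real (\<pi> x) = (real x / real (\<pi> x) - \<beta>) * real (\<pi> x)"
          using pos by (simp add: left_diff_distrib)
        then have "\<bar>real x - \<beta> * real (\<pi> x)\<bar> = \<bar>real x / real (\<pi> x) - \<beta>\<bar> * real (\<pi> x)"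
          by (simp add: abs_mult)
        also have "\<dots> \<le> \<epsilon> * real (\<pi> x)"
          using N[of n] False unfolding n \<pi>x[unfolded n] by (intro mult_right_mono) auto
        finally show ?thesis using \<open>C \<ge> 0\<close> by simp
      qed
    qed
  qed
  then show "\<exists>C. \<forall>x\<in>upper. \<bar>real x - \<beta> * real (\<pi> x)\<bar> \<le> \<epsilon> * real (\<pi> x) + C" by blast
qed

lemma a_seq_le_b_seq: "a_seq n \<le> b_seq n"
  using enumerate_in_set[OF infinite_le_\<pi>, of n] by (simp add: a_seq_def b_seq_def)

lemma a_seq_pos: "n > 0 \<Longrightarrow> a_seq n > 0"
  using strict_mono_enumerate[OF infinite_le_\<pi>] unfolding a_seq_def strict_mono_def
  by (metis not_gr_zero not_less_zero)

lemma no_ratio_limit: "\<not> (\<lambda>n. real (a_seq n) / real (b_seq n)) \<longlonglongrightarrow> \<beta>"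
proof
  assume lim: "(\<lambda>n. real (a_seq n) / real (b_seq n)) \<longlonglongrightarrow> \<beta>"
  have "real (a_seq n) / real (b_seq n) \<le> 1" for n
    using a_seq_le_b_seq[of n] by (simp add: divide_le_eq)
  then have "\<beta> \<le> 1"
    by (intro tendsto_upperbound[OF lim always_eventually]) auto
  moreover have "0 \<le> \<beta>"
    by (intro tendsto_lowerbound[OF lim always_eventually]) auto
  ultimately show False
    using not_upper_slope upper_slopeI[OF lim] by blast
qed

theorem theorem3p5:
  "\<not> convergent (\<lambda>n. real (b_seq n) / real (a_seq n)) \<and>
   \<not> filterlim (\<lambda>n. real (b_seq n) / real (a_seq n)) at_top sequentially"
proof
  \<comment> \<open>Inverting treats both cases alike: a finite limit \<open>L \<ge> 1\<close> gives
    the limit \<open>1 / L\<close>, an infinite one the limit 0.\<close>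
  have inv: "(\<lambda>n. inverse (real (b_seq n) / real (a_seq n))) = (\<lambda>n. real (a_seq n) / real (b_seq n))"
    by simp
  show "\<not> convergent (\<lambda>n. real (b_seq n) / real (a_seq n))"
  proof
    assume "convergent (\<lambda>n. real (b_seq n) / real (a_seq n))"
    then obtain L where L: "(\<lambda>n. real (b_seq n) / real (a_seq n)) \<longlonglongrightarrow> L"
      by (auto simp: convergent_def)
    \<comment> \<open>Index 0 is left out because the quotient there is \<open>0 / 0 = 0\<close>.
      The bound ensures \<open>L \<noteq> 0\<close>, so that the limit can be inverted.\<close>
    have "1 \<le> real (b_seq n) / real (a_seq n)" if "n \<ge> 1" for n
      using a_seq_le_b_seq[of n] a_seq_pos[of n] that by simp
    then have "1 \<le> L"
      by (intro tendsto_lowerbound[OF L eventually_sequentiallyI]) auto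
    with tendsto_inverse[OF L] show False
      unfolding inv using no_ratio_limit by auto
  qed
  show "\<not> filterlim (\<lambda>n. real (b_seq n) / real (a_seq n)) at_top sequentially"
    using tendsto_inverse_0_at_top[of "\<lambda>n. real (b_seq n) / real (a_seq n)" sequentially] no_ratio_limit
    unfolding inv by blast
qed

end
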